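(* Let $V$ be a link invariant defined within a linking class. If $V$ is a finite type invariant of type $n$ in the double crossing change theory, then $V$ is also of finite type in the Borromean clasp theory, and is also of type $n$ there (though possibly also of lower type).
   Context: Links are oriented links in $S^3$ with ordered components. A linking class is the set of all links with a given linking matrix. Double crossing change theory. The operation changes a pair of crossings of opposite sign, both crossings being between the same two components (which may coincide). A singular link of degree $m$ is a link with $m$ ordered pairs of double points, both double points of each pair involving the same two components; the first double point of a pair is labeled $+$ and the second $-$. An invariant $V$ is extended to singular links by setting, for each pair, $V(\text{singular})=V(\text{first resolved positively, second negatively})-V(\text{first resolved negatively, second positively})$; all full resolutions lie in a single linking class, the linking class of the singular link. $V$ is of type $m$ if it vanishes on all singular links in the linking class of degree $\geq m+1$, and of finite type if it is of type $m$ for some finite $m$. Borromean clasp theory. A $3$-component string link is a proper embedding of three ordered, oriented arcs in $D^2\times[0,1]$, the $r$th arc running from a fixed point $p_r$ at one end to $p_r$ at the other; multiplication is concatenation. For $a<b$, $x_{ab}$ is the standard pure braid generator in which all strands except the $b$th are straight and the $b$th strand encircles the $a$th strand once with linking number $+1$. Commutators are $[u,v]=uvu^{-1}v^{-1}$. A singular link of degree $m$ is a link with $m$ triple points, each labeled by a commutator $\sigma=[x_{13}^{\pm1},x_{23}^{\pm1}]^{\pm1}$ on its three strands. Equivalently: $m$ disjoint balls are specified, each identified with $D^2\times[0,1]$ and containing three strands of the link; each ball can be filled with the string link $\sigma$ ("clasped") or the trivial string link ("unclasped"); this does not change the linking class. $V$ is extended by $V(\text{singular})=V(\text{clasped})-V(\text{unclasped})$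 at each triple point. $V$ is of type $m$ if it vanishes on all singular links in the linking class of degree $\geq m+1$, and of finite type if it is of type $m$ for some finite $m$. *)

theory Defs
  imports "HOL-Complex_Analysis.Contour_Integration"
begin

unbundle no cross3_syntax

section \<open>Links in the 3-sphere\<close>

text \<open>
  Euclidean 3-space is \<open>complex \<times> real\<close>, oriented by \<open>(Re w, Im w, z)\<close>. The 3-sphere is the unit
  sphere of \<open>(complex \<times> real) \<times> real\<close>; inverse stereographic projection \<open>from_space\<close> identifies
  3-space with the complement of the north pole \<open>(0, 1)\<close>, and the 3-sphere carries the orientation
  for which this identification preserves orientation.
\<close>

type_synonym space = "complex \<times> real"
type_synonym point = "space \<times> real"

definition S3 :: "point set" where
  "S3 = sphere 0 1"

definition from_space :: "space \<Rightarrow> point" where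
  "from_space x = ((2 / ((norm x)\<^sup>2 + 1)) *\<^sub>R x, ((norm x)\<^sup>2 - 1) / ((norm x)\<^sup>2 + 1))"

definition ambient_isotopy :: "(real \<Rightarrow> point \<Rightarrow> point) \<Rightarrow> bool" where
  "ambient_isotopy H \<longleftrightarrow>
     continuous_on ({0..1} \<times> S3) (\<lambda>(t, x). H t x) \<and>
     (\<forall>t\<in>{0..1}. \<exists>g. homeomorphism S3 S3 (H t) g) \<and>
     (\<forall>x\<in>S3. H 0 x = x)"

text \<open>
  The components of a \<open>\<mu>\<close>-component oriented link are numbered \<open>0, \<dots>, \<mu> - 1\<close> and given by 1-periodic
  parametrisations. Only the oriented image of each component matters, so an isotopy may end with
  an orientation preserving reparametrisation. Values at indices \<open>\<ge> \<mu>\<close> are irrelevant.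
\<close>

type_synonym 'p curves = "nat \<Rightarrow> real \<Rightarrow> 'p"

definition reparametrisation :: "(real \<Rightarrow> real) \<Rightarrow> bool" where
  "reparametrisation \<theta> \<longleftrightarrow>
     continuous_on UNIV \<theta> \<and> strict_mono \<theta> \<and> (\<forall>t. \<theta> (t + 1) = \<theta> t + 1)"

definition isotopic :: "nat \<Rightarrow> point curves \<Rightarrow> point curves \<Rightarrow> bool" where
  "isotopic \<mu> L L' \<longleftrightarrow>
     (\<exists>H \<theta>. ambient_isotopy H \<and>
        (\<forall>i<\<mu>. reparametrisation (\<theta> i) \<and> (\<forall>t. H 1 (L i t) = L' i (\<theta> i t))))"

definition closed_curves :: "nat \<Rightarrow> 'p::topological_space curves \<Rightarrow> bool" where
  "closed_curves \<mu> L \<longleftrightarrow>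
     (\<forall>i<\<mu>. continuous_on UNIV (L i) \<and> (\<forall>t. L i (t + 1) = L i t))"

definition embedded :: "nat \<Rightarrow> 'p curves \<Rightarrow> bool" where
  "embedded \<mu> L \<longleftrightarrow>
     (\<forall>i<\<mu>. \<forall>j<\<mu>. \<forall>s t. L i s = L j t \<longrightarrow> i = j \<and> s - t \<in> \<int>)"

definition smooth_link :: "nat \<Rightarrow> space curves \<Rightarrow> bool" where
  "smooth_link \<mu> K \<longleftrightarrow>
     closed_curves \<mu> K \<and> embedded \<mu> K \<and>
     (\<forall>i<\<mu>. K i C1_differentiable_on UNIV \<and> (\<forall>t. vector_derivative (K i) (at t) \<noteq> 0))"

text \<open>The last condition is tameness.\<close>

definition link :: "nat \<Rightarrow> point curves \<Rightarrow> bool" where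
  "link \<mu> L \<longleftrightarrow>
     closed_curves \<mu> L \<and> embedded \<mu> L \<and> (\<forall>i<\<mu>. range (L i) \<subseteq> S3) \<and>
     (\<exists>K. smooth_link \<mu> K \<and> isotopic \<mu> L (\<lambda>i t. from_space (K i t)))"

text \<open>
  Linking numbers are Gauss integrals, computed after moving the link by an isotopy to a smooth link
  that misses the north pole. Only off-diagonal entries of a linking matrix are meaningful.
\<close>

definition vec3 :: "space \<Rightarrow> real^3" where
  "vec3 x = vector [Re (fst x), Im (fst x), snd x]"

definition linking_number :: "(real \<Rightarrow> space) \<Rightarrow> (real \<Rightarrow> space) \<Rightarrow> real" where
  "linking_number \<gamma> \<delta> = 1 / (4 * pi) *
     integral {0..1} (\<lambda>s. integral {0..1} (\<lambda>t.
       (cross3 (vec3 (vector_derivative \<gamma> (at s))) (vec3 (vector_derivative \<delta> (at t)))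
          \<bullet> vec3 (\<gamma> s - \<delta> t)) / norm (\<gamma> s - \<delta> t) ^ 3))"

definition linking_class :: "nat \<Rightarrow> (nat \<Rightarrow> nat \<Rightarrow> int) \<Rightarrow> point curves set" where
  "linking_class \<mu> M =
     {L. link \<mu> L \<and>
         (\<exists>K. smooth_link \<mu> K \<and> isotopic \<mu> L (\<lambda>i t. from_space (K i t)) \<and>
              (\<forall>i<\<mu>. \<forall>j<\<mu>. i \<noteq> j \<longrightarrow> linking_number (K i) (K j) = of_int (M i j)))}"

definition link_invariant_on :: "nat \<Rightarrow> point curves set \<Rightarrow> (point curves \<Rightarrow> 'a) \<Rightarrow> bool" where
  "link_invariant_on \<mu> C V \<longleftrightarrow> (\<forall>L\<in>C. \<forall>L'\<in>C. isotopic \<mu> L L' \<longrightarrow> V L = V L')"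


section \<open>Balls meeting a link in prescribed strands\<close>

text \<open>
  A chart is an identification of a ball in the 3-sphere with \<open>D\<^sup>2 \<times> [0,1]\<close> that preserves
  orientation. It is expressed by transporting the standard copy of \<open>D\<^sup>2 \<times> [0,1]\<close> by an ambient
  isotopy.
\<close>

definition cylinder :: "space set" where
  "cylinder = cball 0 1 \<times> {0..1}"

definition is_chart :: "(space \<Rightarrow> point) \<Rightarrow> bool" where
  "is_chart \<phi> \<longleftrightarrow> (\<exists>H. ambient_isotopy H \<and> (\<forall>x\<in>cylinder. \<phi> x = H 1 (from_space x)))"

text \<open>
  \<open>B :: strands\<close> stands for the arcs \<open>{(B r z, z) | 0 \<le> z \<le> 1}\<close> in \<open>D\<^sup>2 \<times> [0,1]\<close>, \<open>r = 1, 2, \<dots>\<close>,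
  oriented from \<open>z = 0\<close> to \<open>z = 1\<close>.
\<close>

type_synonym strands = "nat \<Rightarrow> real \<Rightarrow> complex"

text \<open>
  A system of curves with a family of charted balls indexed by \<open>'s\<close>. The \<open>r\<close>th strand in the ball
  \<open>s\<close> belongs to component \<open>comp S s r\<close>, and its point at height \<open>z\<close> has parameter \<open>par S s r z\<close>.
\<close>

record 's sited_curves =
  curve :: "point curves"
  chart :: "'s \<Rightarrow> space \<Rightarrow> point"
  comp :: "'s \<Rightarrow> nat \<Rightarrow> nat"
  par :: "'s \<Rightarrow> nat \<Rightarrow> real \<Rightarrow> real"

definition at_site :: "'s sited_curves \<Rightarrow> 's \<Rightarrow> nat \<Rightarrow> real \<Rightarrow> nat \<Rightarrow> real \<Rightarrow> bool" where
  "at_site S s r z i t \<longleftrightarrow> z \<in> {0..1} \<and> i = comp S s r \<and> t - par S s r z \<in> \<int>"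

definition sites :: "nat \<Rightarrow> nat \<Rightarrow> strands \<Rightarrow> 's set \<Rightarrow> 's sited_curves \<Rightarrow> bool" where
  "sites \<mu> n B I S \<longleftrightarrow>
     (\<forall>s\<in>I. is_chart (chart S s)) \<and>
     (\<forall>s\<in>I. \<forall>s'\<in>I. s \<noteq> s' \<longrightarrow> chart S s ` cylinder \<inter> chart S s' ` cylinder = {}) \<and>
     (\<forall>s\<in>I. \<forall>r\<in>{1..n}.
        comp S s r < \<mu> \<and>
        continuous_on {0..1} (par S s r) \<and> strict_mono_on {0..1} (par S s r) \<and>
        (\<forall>z\<in>{0..1}. curve S (comp S s r) (par S s r z) = chart S s (B r z, z))) \<and>
     (\<forall>s\<in>I. \<forall>i<\<mu>. \<forall>t. curve S i t \<in> chart S s ` cylinder \<longrightarrow>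
        (\<exists>r\<in>{1..n}. \<exists>z. at_site S s r z i t))"

text \<open>
  The curves obtained by filling the ball \<open>s\<close> with the strands \<open>F s\<close>, for all \<open>s \<in> I\<close>. The description
  is unique whenever \<open>S\<close> is one of the singular links below.
\<close>

definition fill :: "nat \<Rightarrow> 's set \<Rightarrow> 's sited_curves \<Rightarrow> ('s \<Rightarrow> strands) \<Rightarrow> point curves" where
  "fill n I S F i t =
     (if \<exists>s\<in>I. \<exists>r\<in>{1..n}. \<exists>z. at_site S s r z i t
      then THE p. \<exists>s\<in>I. \<exists>r\<in>{1..n}. \<exists>z. at_site S s r z i t \<and> p = chart S s (F s r z, z)
      else curve S i t)"

text \<open>
  The extension of an invariant over \<open>m\<close> singularities: \<open>f A\<close> is its value on the full resolution in
  which exactly the singularities in \<open>A \<subseteq> {..<m}\<close> are resolved in the way that counts positively.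
\<close>

primrec alternating :: "nat \<Rightarrow> (nat set \<Rightarrow> 'a::ab_group_add) \<Rightarrow> 'a" where
  "alternating 0 f = f {}"
| "alternating (Suc m) f = alternating m (\<lambda>A. f (insert m A)) - alternating m f"


section \<open>Double crossing change theory\<close>

text \<open>
  Two strands crossing once: a double point at \<open>(0, 1/2)\<close> for \<open>e = 0\<close>, a positive crossing for
  \<open>e = 1\<close> and a negative one for \<open>e = -1\<close>. Seen from the side \<open>Im w < 0\<close> with \<open>z\<close> pointing up and
  \<open>Re w\<close> to the right, strand 1 runs from lower left to upper right and, for \<open>e = 1\<close>, is the
  over-strand.
\<close>

definition crossing :: "real \<Rightarrow> strands" where
  "crossing e r z =
     (if r = 1 then Complex (z - 1/2) (- e * min z (1 - z)) else Complex (1/2 - z) 0)"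

text \<open>
  The \<open>k\<close>th pair of double points consists of the sites \<open>(k, True)\<close> (the first one, labelled \<open>+\<close>)
  and \<open>(k, False)\<close> (the second one, labelled \<open>-\<close>).
\<close>

definition double_sites :: "nat \<Rightarrow> (nat \<times> bool) set" where
  "double_sites m = {..<m} \<times> UNIV"

definition double_singular_link :: "nat \<Rightarrow> nat \<Rightarrow> (nat \<times> bool) sited_curves \<Rightarrow> bool" where
  "double_singular_link \<mu> m S \<longleftrightarrow>
     closed_curves \<mu> (curve S) \<and> (\<forall>i<\<mu>. range (curve S i) \<subseteq> S3) \<and>
     sites \<mu> 2 (crossing 0) (double_sites m) S \<and>
     (\<forall>i<\<mu>. \<forall>j<\<mu>. \<forall>t u. curve S i t = curve S j u \<longrightarrow>
        (i = j \<and> t - u \<in> \<int>) \<or> (\<exists>s\<in>double_sites m. curve S i t = chart S s (0, 1/2))) \<and>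
     (\<forall>k<m. {comp S (k, True) 1, comp S (k, True) 2} = {comp S (k, False) 1, comp S (k, False) 2})"

text \<open>Pairs \<open>k \<in> A\<close> are resolved first positively, second negatively; the others the other way round.\<close>

definition double_resolution ::
    "nat \<Rightarrow> (nat \<times> bool) sited_curves \<Rightarrow> nat set \<Rightarrow> point curves" where
  "double_resolution m S A =
     fill 2 (double_sites m) S (\<lambda>(k, first). crossing (if (k \<in> A) = first then 1 else - 1))"

definition double_type ::
    "nat \<Rightarrow> (nat \<Rightarrow> nat \<Rightarrow> int) \<Rightarrow> nat \<Rightarrow> (point curves \<Rightarrow> 'a::ab_group_add) \<Rightarrow> bool" where
  "double_type \<mu> M m V \<longleftrightarrow>
     (\<forall>d\<ge>m + 1. \<forall>S. double_singular_link \<mu> d S \<longrightarrow>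
        (\<forall>A\<subseteq>{..<d}. double_resolution d S A \<in> linking_class \<mu> M) \<longrightarrow>
        alternating d (\<lambda>A. V (double_resolution d S A)) = 0)"


section \<open>Borromean clasp theory\<close>

definition base_point :: "nat \<Rightarrow> complex" where
  "base_point r = (of_nat r - 2) / 2"

definition trivial_strands :: strands where
  "trivial_strands r = (\<lambda>z. base_point r)"

text \<open>
  The pure braid generator \<open>x\<^sub>a\<^sub>b\<close> for \<open>a < b\<close>: strand \<open>b\<close> passes on the side \<open>Im w < 0\<close> of the strands
  between \<open>a\<close> and \<open>b\<close>, winds once counterclockwise (as \<open>z\<close> increases) around strand \<open>a\<close>, and returns
  the same way.
\<close>

definition pure_braid_gen :: "nat \<Rightarrow> nat \<Rightarrow> strands" where
  "pure_braid_gen a b =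
     trivial_strands(b :=
       linepath (base_point b) (base_point a - \<i> / 4) +++
       part_circlepath (base_point a) (1/4) (- (pi / 2)) (3 * pi / 2) +++
       linepath (base_point a - \<i> / 4) (base_point b))"

definition braid_mult :: "strands \<Rightarrow> strands \<Rightarrow> strands" where
  "braid_mult u v = (\<lambda>r. u r +++ v r)"

definition braid_inverse :: "strands \<Rightarrow> strands" where
  "braid_inverse u = (\<lambda>r. reversepath (u r))"

definition braid_commutator :: "strands \<Rightarrow> strands \<Rightarrow> strands" where
  "braid_commutator u v =
     braid_mult (braid_mult (braid_mult u v) (braid_inverse u)) (braid_inverse v)"

text \<open>\<open>True\<close> stands for the exponent \<open>1\<close> and \<open>False\<close> for \<open>-1\<close>.\<close>

definition braid_sign_power :: "strands \<Rightarrow> bool \<Rightarrow> strands" where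
  "braid_sign_power u e = (if e then u else braid_inverse u)"

fun borromean_clasp :: "bool \<times> bool \<times> bool \<Rightarrow> strands" where
  "borromean_clasp (e1, e2, e) =
     braid_sign_power
       (braid_commutator (braid_sign_power (pure_braid_gen 1 3) e1)
                         (braid_sign_power (pure_braid_gen 2 3) e2)) e"

text \<open>
  A singular link is represented by its unclasped resolution with the specified balls; the triple
  point in the \<open>k\<close>th ball carries a label which is an argument of \<open>borromean_clasp\<close>.
\<close>

definition borromean_singular_link :: "nat \<Rightarrow> nat \<Rightarrow> nat sited_curves \<Rightarrow> bool" where
  "borromean_singular_link \<mu> m S \<longleftrightarrow>
     link \<mu> (curve S) \<and> sites \<mu> 3 trivial_strands {..<m} S"

definition borromean_resolution ::
    "nat \<Rightarrow> nat sited_curves \<Rightarrow> (nat \<Rightarrow> bool \<times> bool \<times> bool) \<Rightarrow> nat set \<Rightarrow> point curves" where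
  "borromean_resolution m S \<sigma> A =
     fill 3 {..<m} S (\<lambda>k. if k \<in> A then borromean_clasp (\<sigma> k) else trivial_strands)"

definition borromean_type ::
    "nat \<Rightarrow> (nat \<Rightarrow> nat \<Rightarrow> int) \<Rightarrow> nat \<Rightarrow> (point curves \<Rightarrow> 'a::ab_group_add) \<Rightarrow> bool" where
  "borromean_type \<mu> M m V \<longleftrightarrow>
     (\<forall>d\<ge>m + 1. \<forall>S \<sigma>. borromean_singular_link \<mu> d S \<longrightarrow>
        (\<forall>A\<subseteq>{..<d}. borromean_resolution d S \<sigma> A \<in> linking_class \<mu> M) \<longrightarrow>
        alternating d (\<lambda>A. V (borromean_resolution d S \<sigma> A)) = 0)"

definition borromean_finite_type ::
    "nat \<Rightarrow> (nat \<Rightarrow> nat \<Rightarrow> int) \<Rightarrow> (point curves \<Rightarrow> 'a::ab_group_add) \<Rightarrow> bool" where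
  "borromean_finite_type \<mu> M V \<longleftrightarrow> (\<exists>m. borromean_type \<mu> M m V)"

end

theory Submission
  imports Defs
begin

text \<open>
  In the third strand of a clasp \<open>[x\<^sub>1\<^sub>3, x\<^sub>2\<^sub>3]\<close> change the crossing with the first strand where
  \<open>x\<^sub>1\<^sub>3\<close> winds around it, and the opposite one in \<open>x\<^sub>1\<^sub>3\<^sup>-\<^sup>1\<close>. Both factors become trivial, and
  \<open>x\<^sub>2\<^sub>3 x\<^sub>2\<^sub>3\<^sup>-\<^sup>1\<close> cancels. Hence clasping and unclasping differ by one double crossing change, and a
  Borromean singular link has, up to isotopy, the same resolutions as a double crossing singular link
  of the same degree.

  Only the third strand of a clasp moves, so a clasp is a loop in the disc punctured at the base points
  of the first two strands, and homotopies of such loops are realised by ambient isotopies composed of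
  small pushes. The two crossings are made by passing this loop on either side of the first puncture
  (\<open>half_turn 1\<close> or \<open>half_turn (- 1)\<close>), the double points by passing through it (\<open>half_turn 0\<close>).
\<close>

section \<open>Stereographic projection and ambient isotopies\<close>

text \<open>Two obstacles shape the proof. First, a homotopy moves the third strand far, and it may
  pass through its own earlier positions; a push is a homeomorphism only if it moves points by less
  than the radius of its bump. So a homotopy is cut into short steps, with one radius, found by
  compactness, that keeps all bumps off the first two strands. Second, the double singular link is
  not embedded, so no isotopy produces it from the given link; its continuity comes from self-maps
  of the sphere that need not be injective. Tameness and linking numbers of its resolutions are
  carried over from the Borromean resolutions.

  Two facts make the theories match. Both crossings of a pair are between strands 3 and 1 of one
  ball, so the condition on components holds whatever these components are. And each pair can be
  labelled so that the positively resolved pairs are the clasped balls; the two alternating sums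
  then agree term by term.\<close>

definition north :: point where
  "north = (0, 1)"

definition to_space :: "point \<Rightarrow> space" where
  "to_space p = (1 / (1 - snd p)) *\<^sub>R fst p"

lemma norm_point_sq: "(norm (p :: point))\<^sup>2 = (norm (fst p))\<^sup>2 + (snd p)\<^sup>2"
  by (cases p) (simp add: norm_Pair)

lemma S3_iff: "p \<in> S3 \<longleftrightarrow> (norm (fst p))\<^sup>2 + (snd p)\<^sup>2 = 1"
  unfolding S3_def norm_point_sq [symmetric]
  by (simp add: power2_eq_1_iff order_antisym_conv) (metis abs_norm_cancel abs_minus_cancel abs_one)

lemma norm_sq_add_one_pos: "(norm (x :: 'a::real_normed_vector))\<^sup>2 + 1 > 0"
  by (smt (verit) zero_le_power2)

lemma from_space_S3 [simp]: "from_space x \<in> S3"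
proof -
  have "(norm x)\<^sup>2 + 1 \<noteq> 0" using norm_sq_add_one_pos [of x] by linarith
  then have "(2 / ((norm x)\<^sup>2 + 1) * norm x)\<^sup>2 + (((norm x)\<^sup>2 - 1) / ((norm x)\<^sup>2 + 1))\<^sup>2 = 1"
    by (simp add: power_divide field_simps) (simp add: power2_eq_square algebra_simps)
  then show ?thesis
    using norm_sq_add_one_pos [of x] by (simp add: S3_iff from_space_def)
qed

lemma from_space_neq_north [simp]: "from_space x \<noteq> north" "north \<noteq> from_space x"
  using norm_sq_add_one_pos [of x] by (auto simp: from_space_def north_def field_simps)

lemma to_from_space [simp]: "to_space (from_space x) = x"
proof -
  have *: "1 - ((norm x)\<^sup>2 - 1) / ((norm x)\<^sup>2 + 1) = 2 / ((norm x)\<^sup>2 + 1)"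
    using norm_sq_add_one_pos [of x] by (simp add: field_simps)
  show ?thesis
    using norm_sq_add_one_pos [of x]
    by (simp add: to_space_def from_space_def * del: divide_divide_eq_right divide_divide_eq_left)
      (simp add: less_imp_neq [symmetric])
qed

lemma north_S3 [simp]: "north \<in> S3"
  by (simp add: north_def S3_def norm_Pair)

lemma S3_snd_less_1:
  assumes "p \<in> S3" "p \<noteq> north"
  shows "snd p < 1"
proof (rule ccontr)
  assume "\<not> snd p < 1"
  then have "(snd p)\<^sup>2 \<ge> 1" by simp
  moreover have "(norm (fst p))\<^sup>2 + (snd p)\<^sup>2 = 1" using assms(1) by (simp add: S3_iff)
  moreover have "(norm (fst p))\<^sup>2 \<ge> 0" by simp
  ultimately have "(norm (fst p))\<^sup>2 = 0" "(snd p)\<^sup>2 = 1" by linarith+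
  with \<open>\<not> snd p < 1\<close> have "fst p = 0" "snd p = 1"
    by (auto simp: power2_eq_1_iff)
  with assms(2) show False
    by (simp add: north_def prod_eq_iff)
qed

lemma from_to_space [simp]:
  assumes "p \<in> S3" "p \<noteq> north"
  shows "from_space (to_space p) = p"
proof -
  obtain x u where p: "p = (x, u)" by (cases p)
  have u: "u < 1" using S3_snd_less_1 [OF assms] p by simp
  have n: "(norm x)\<^sup>2 = (1 - u) * (1 + u)"
    using assms(1) p by (simp add: S3_iff power2_eq_square algebra_simps)
  have 1: "(norm (to_space p))\<^sup>2 = (1 + u) / (1 - u)"
  proof -
    have "(norm (to_space p))\<^sup>2 = (1 - u) * (1 + u) / ((1 - u) * (1 - u))"
      by (simp add: to_space_def p power_divide n) (simp add: power2_eq_square)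
    then show ?thesis using u by simp
  qed
  have 2: "(1 + u) / (1 - u) + 1 = 2 / (1 - u)" "(1 + u) / (1 - u) - 1 = 2 * u / (1 - u)"
    using u by (simp_all add: field_simps)
  show ?thesis
    unfolding from_space_def 1 2 using u by (simp add: to_space_def p)
qed

lemma continuous_from_space: "continuous_on UNIV from_space"
  unfolding from_space_def
  by (intro continuous_intros) (metis norm_sq_add_one_pos less_irrefl)+

lemma continuous_to_space: "continuous_on (S3 - {north}) to_space"
  unfolding to_space_def using S3_snd_less_1 by (intro continuous_intros) force

section \<open>Extending maps of 3-space over the north pole\<close>

lemma dist_from_space_north: "dist (from_space x) north = 2 / sqrt ((norm x)\<^sup>2 + 1)"
proof -
  let ?m = "(norm x)\<^sup>2 + 1"
  have m: "?m > 0" by (rule norm_sq_add_one_pos)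
  have "(norm x)\<^sup>2 = ?m - 1" by simp
  have "(dist (from_space x) north)\<^sup>2 = (2 / ?m * norm x)\<^sup>2 + ((?m - 2) / ?m - 1)\<^sup>2"
    using m by (simp add: dist_norm norm_point_sq from_space_def north_def)
  also have "\<dots> = 4 * (?m - 1) / ?m\<^sup>2 + 4 / ?m\<^sup>2"
  proof -
    have "(?m - 2) / ?m - 1 = - 2 / ?m" using m by (simp add: field_simps)
    then show ?thesis by (simp add: power_mult_distrib power_divide)
  qed
  also have "\<dots> = (2 / sqrt ?m)\<^sup>2"
  proof -
    have "4 * (c - 1) / c\<^sup>2 + 4 / c\<^sup>2 = (2 / sqrt c)\<^sup>2" if "c > 0" for c :: real
      unfolding add_divide_distrib [symmetric] using that by (simp add: power_divide) (simp add: power2_eq_square)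
    then show ?thesis using m .
  qed
  finally show ?thesis
    using m by (metis divide_nonneg_nonneg power2_eq_iff_nonneg real_sqrt_ge_zero zero_le_dist
        less_imp_le zero_le_numeral)
qed

definition lift :: "(space \<Rightarrow> space) \<Rightarrow> point \<Rightarrow> point" where
  "lift g p = (if p = north then north else from_space (g (to_space p)))"

lemma lift_from_space [simp]: "lift g (from_space x) = from_space (g x)"
  by (simp add: lift_def)

lemma lift_S3: "lift g p \<in> S3"
  by (simp add: lift_def)

text \<open>The distance of \<open>from_space x\<close> to the pole depends on \<open>norm x\<close>
  only, so the growth bound makes the lift Lipschitz at the pole with constant
  \<open>sqrt K\<close>, uniformly in t. Elsewhere the lift is a composition of continuous
  maps.\<close>

lemma continuous_lift:
  fixes G :: "'b::metric_space \<Rightarrow> space \<Rightarrow> space"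
  assumes cont: "continuous_on (T \<times> UNIV) (\<lambda>(t, x). G t x)"
    and growth: "\<And>t x. t \<in> T \<Longrightarrow> (norm x)\<^sup>2 + 1 \<le> K * ((norm (G t x))\<^sup>2 + 1)"
  shows "continuous_on (T \<times> S3) (\<lambda>(t, p). lift (G t) p)"
proof -
  have K: "K > 0" if "t \<in> T" for t
    using growth [OF that, of 0] by (smt (verit) mult_nonpos_nonneg zero_le_power2 norm_sq_add_one_pos)
  have near: "dist (lift (G t) p) north \<le> sqrt K * dist p north" if "t \<in> T" "p \<in> S3" for t p
  proof (cases "p = north")
    case False
    define x where "x = to_space p"
    have p: "p = from_space x" using False that by (simp add: x_def)
    have "sqrt ((norm x)\<^sup>2 + 1) \<le> sqrt K * sqrt ((norm (G t x))\<^sup>2 + 1)"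
      using growth [OF that(1), of x] by (simp flip: real_sqrt_mult)
    then show ?thesis
      using norm_sq_add_one_pos [of x] norm_sq_add_one_pos [of "G t x"]
      by (simp add: p dist_from_space_north field_simps)
  qed (simp add: lift_def)
  have off: "continuous_on (T \<times> (S3 - {north})) (\<lambda>(t, p). lift (G t) p)"
  proof -
    have "continuous_on (T \<times> (S3 - {north})) (\<lambda>x. (fst x, to_space (snd x)))"
      by (intro continuous_intros continuous_on_compose2 [OF continuous_to_space]) auto
    then have "continuous_on (T \<times> (S3 - {north})) (\<lambda>x. (\<lambda>(t, x). G t x) (fst x, to_space (snd x)))"
      by (rule continuous_on_compose2 [OF cont]) auto
    then have "continuous_on (T \<times> (S3 - {north}))
        (\<lambda>x. from_space ((\<lambda>(t, x). G t x) (fst x, to_space (snd x))))"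
      by (rule continuous_on_compose2 [OF continuous_from_space]) auto
    then show ?thesis
      by (rule continuous_on_eq) (auto simp only: lift_def case_prod_unfold mem_Times_iff Diff_iff singleton_iff fst_conv snd_conv if_False)
  qed
  show ?thesis
    unfolding continuous_on_eq_continuous_within
  proof (intro ballI)
    fix y assume y: "y \<in> T \<times> S3"
    obtain t p where tp: "y = (t, p)" "t \<in> T" "p \<in> S3" using y by auto
    show "continuous (at y within T \<times> S3) (\<lambda>(t, p). lift (G t) p)"
    proof (cases "p = north")
      case True
      have "((\<lambda>(t, p). lift (G t) p) \<longlongrightarrow> north) (at y within T \<times> S3)"
      proof (rule metric_tendsto_imp_tendsto)
        have "((\<lambda>y. sqrt K * dist (snd y) north) \<longlongrightarrow> sqrt K * dist (snd y) north) (at y within T \<times> S3)"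
          by (intro tendsto_intros)
        then show "((\<lambda>y. sqrt K * dist (snd y) north) \<longlongrightarrow> 0) (at y within T \<times> S3)"
          using True by (simp add: tp)
        show "\<forall>\<^sub>F x in at y within T \<times> S3.
            dist (case x of (t, p) \<Rightarrow> lift (G t) p) north \<le> dist (sqrt K * dist (snd x) north) 0"
          unfolding eventually_at_filter using near
          by (intro always_eventually) (force intro: order_trans [OF _ abs_ge_self])
      qed
      then show ?thesis using True by (simp add: continuous_within tp lift_def)
    next
      case False
      have "continuous (at y within T \<times> (S3 - {north})) (\<lambda>(t, p). lift (G t) p)"
        using off False tp by (simp add: continuous_on_eq_continuous_within)
      moreover have "at y within T \<times> (S3 - {north}) = at y within T \<times> S3"
        by (rule at_within_nhd [of _ "UNIV \<times> (- {north})"])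
          (use False tp in \<open>auto intro!: open_Times open_Compl\<close>)
      ultimately show ?thesis by simp
    qed
  qed
qed

lemma compact_S3: "compact S3"
  by (simp add: S3_def)

text \<open>Brings the linear estimate natural for affine maps into the quadratic form that
  \<open>continuous_lift\<close> requires; the factor 2 comes from the square of
  \<open>norm y - 1\<close> being nonnegative.\<close>

lemma growth_of_affine_bound:
  fixes x :: "'a::real_normed_vector" and y :: "'b::real_normed_vector"
  assumes "norm x \<le> C * (norm y + 1)"
  shows "(norm x)\<^sup>2 + 1 \<le> (2 * C\<^sup>2 + 1) * ((norm y)\<^sup>2 + 1)"
proof -
  have "(norm x)\<^sup>2 \<le> C\<^sup>2 * (norm y + 1)\<^sup>2"
    using power_mono [OF assms, of 2] by (simp add: power_mult_distrib)
  also have "\<dots> \<le> C\<^sup>2 * (2 * ((norm y)\<^sup>2 + 1))"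
    using zero_le_power2 [of "norm y - 1"]
    by (intro mult_left_mono) (auto simp: power2_eq_square algebra_simps)
  finally show ?thesis
    by (simp add: algebra_simps add_increasing)
qed

section \<open>Constructing ambient isotopies\<close>

lemma ambient_isotopyD:
  assumes "ambient_isotopy H"
  shows "continuous_on ({0..1} \<times> S3) (\<lambda>(t, x). H t x)"
    and "t \<in> {0..1} \<Longrightarrow> \<exists>g. homeomorphism S3 S3 (H t) g"
    and "t \<in> {0..1} \<Longrightarrow> p \<in> S3 \<Longrightarrow> H t p \<in> S3"
    and "p \<in> S3 \<Longrightarrow> H 0 p = p"
  using assms unfolding ambient_isotopy_def homeomorphism_def by blast+

text \<open>On the compact sphere a continuous bijection has a continuous inverse, so only
  bijectivity has to be checked at each time.\<close>

lemma ambient_isotopyI: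
  assumes cont: "continuous_on ({0..1} \<times> S3) (\<lambda>(t, x). H t x)"
    and onto: "\<And>t. t \<in> {0..1} \<Longrightarrow> H t ` S3 = S3"
    and inj: "\<And>t. t \<in> {0..1} \<Longrightarrow> inj_on (H t) S3"
    and id: "\<And>p. p \<in> S3 \<Longrightarrow> H 0 p = p"
  shows "ambient_isotopy H"
  unfolding ambient_isotopy_def
proof (intro conjI ballI)
  fix t :: real assume t: "t \<in> {0..1}"
  have "continuous_on S3 (\<lambda>p. (\<lambda>(t, x). H t x) (t, p))"
    by (rule continuous_on_compose2 [OF cont]) (use t in \<open>auto intro!: continuous_intros\<close>)
  then show "\<exists>g. homeomorphism S3 S3 (H t) g"
    using homeomorphism_compact [OF compact_S3 _ onto [OF t] inj [OF t]] by simp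
qed (use cont id in auto)

lemma ambient_isotopy_lift:
  assumes cont: "continuous_on ({0..1} \<times> UNIV) (\<lambda>(t, x). G t x)"
    and growth: "\<And>t x. t \<in> {0..1} \<Longrightarrow> (norm x)\<^sup>2 + 1 \<le> K * ((norm (G t x))\<^sup>2 + 1)"
    and bij: "\<And>t. t \<in> {0..1} \<Longrightarrow> bij (G t)"
    and id: "\<And>x. G 0 x = x"
  shows "ambient_isotopy (\<lambda>t. lift (G t))"
proof (rule ambient_isotopyI)
  show "continuous_on ({0..1} \<times> S3) (\<lambda>(t, x). lift (G t) x)"
    by (rule continuous_lift [OF cont growth])
  show "lift (G t) ` S3 = S3" if "t \<in> {0..1}" for t
  proof -
    have "p \<in> lift (G t) ` S3" if "p \<in> S3" for p
    proof (cases "p = north")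
      case True
      then show ?thesis using image_eqI [of north "lift (G t)" north S3] by (simp add: lift_def)
    next
      case False
      obtain x where "G t x = to_space p" using bij [OF \<open>t \<in> {0..1}\<close>] by (metis bij_pointE)
      then have "lift (G t) (from_space x) = p" using False that by simp
      then show ?thesis by (metis image_eqI from_space_S3)
    qed
    then show ?thesis using lift_S3 by auto
  qed
  show "inj_on (lift (G t)) S3" if "t \<in> {0..1}" for t
  proof (rule inj_onI)
    fix p q assume pq: "p \<in> S3" "q \<in> S3" and eq: "lift (G t) p = lift (G t) q"
    show "p = q"
    proof (cases "p = north \<or> q = north")
      case True
      then show ?thesis using eq unfolding lift_def by (metis from_space_neq_north(1))
    next
      case False
      then have "to_space (from_space (G t (to_space p))) = to_space (from_space (G t (to_space q)))"
        using eq by (simp only: lift_def) simp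
      then have "to_space p = to_space q"
        unfolding to_from_space using bij [OF that] by (metis bij_pointE)
      then show ?thesis using False pq by (metis from_to_space)
    qed
  qed
  show "lift (G 0) p = p" if "p \<in> S3" for p
    using that by (simp add: lift_def id)
qed

lemma ambient_isotopy_comp:
  assumes H: "ambient_isotopy H" and G: "ambient_isotopy G"
  shows "ambient_isotopy (\<lambda>t p. H t (G t p))"
  unfolding ambient_isotopy_def
proof (intro conjI ballI)
  have "continuous_on ({0..1} \<times> S3) (\<lambda>x. (fst x, (\<lambda>(t, p). G t p) x))"
    by (intro continuous_intros ambient_isotopyD(1) [OF G])
  then have "continuous_on ({0..1} \<times> S3) (\<lambda>x. (\<lambda>(t, p). H t p) (fst x, (\<lambda>(t, p). G t p) x))"
    by (rule continuous_on_compose2 [OF ambient_isotopyD(1) [OF H]]) (use ambient_isotopyD(3) [OF G] in auto)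
  then show "continuous_on ({0..1} \<times> S3) (\<lambda>(t, p). H t (G t p))"
    by (simp add: case_prod_unfold)
  show "\<exists>g. homeomorphism S3 S3 (\<lambda>p. H t (G t p)) g" if t: "t \<in> {0..1}" for t
  proof -
    obtain f f' where "homeomorphism S3 S3 (G t) f" "homeomorphism S3 S3 (H t) f'"
      using ambient_isotopyD(2) [OF G t] ambient_isotopyD(2) [OF H t] by blast
    from homeomorphism_compose [OF this] show ?thesis by (auto simp: o_def)
  qed
qed (use ambient_isotopyD [OF H] ambient_isotopyD [OF G] in auto)

text \<open>Carries motions of the standard cylinder over to the ball of a chart, with h the
  homeomorphism of the sphere that the chart comes from.\<close>

lemma ambient_isotopy_conj:
  assumes h: "homeomorphism S3 S3 h g" and G: "ambient_isotopy G"
  shows "ambient_isotopy (\<lambda>t p. h (G t (g p)))"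
  unfolding ambient_isotopy_def
proof (intro conjI ballI)
  have "continuous_on ({0..1} \<times> S3) (\<lambda>x. (fst x, g (snd x)))"
  proof (intro continuous_on_Pair continuous_on_fst continuous_on_id)
    show "continuous_on ({0..1} \<times> S3) (\<lambda>x. g (snd x))"
      by (rule continuous_on_compose2 [OF homeomorphism_cont2 [OF h] continuous_on_snd [OF continuous_on_id]]) auto
  qed
  then have "continuous_on ({0..1} \<times> S3) (\<lambda>x. (\<lambda>(t, p). G t p) (fst x, g (snd x)))"
    by (rule continuous_on_compose2 [OF ambient_isotopyD(1) [OF G]]) (use homeomorphism_image2 [OF h] in auto)
  then have "continuous_on ({0..1} \<times> S3) (\<lambda>x. h ((\<lambda>(t, p). G t p) (fst x, g (snd x))))"
    by (rule continuous_on_compose2 [OF homeomorphism_cont1 [OF h]])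
      (use homeomorphism_image2 [OF h] in \<open>auto intro!: ambient_isotopyD(3) [OF G] simp: image_subset_iff set_eq_subset simp del: split_paired_All\<close>)
  then show "continuous_on ({0..1} \<times> S3) (\<lambda>(t, p). h (G t (g p)))"
    by (simp add: case_prod_unfold)
  show "\<exists>f. homeomorphism S3 S3 (\<lambda>p. h (G t (g p))) f" if t: "t \<in> {0..1}" for t
  proof -
    obtain f where "homeomorphism S3 S3 (G t) f" using ambient_isotopyD(2) [OF G t] by blast
    from homeomorphism_compose [OF homeomorphism_compose [OF homeomorphism_symD [OF h] this] h]
    show ?thesis by (auto simp: o_def)
  qed
  show "h (G 0 (g p)) = p" if "p \<in> S3" for p
  proof -
    have "g p \<in> S3" using h that by (auto simp: homeomorphism_def)
    then show ?thesis using h that by (simp add: ambient_isotopyD(4) [OF G] homeomorphism_apply2)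
  qed
qed

section \<open>Maps supported in a chart\<close>

lemma cylinder_norm:
  assumes "x \<in> cylinder"
  shows "(norm x)\<^sup>2 \<le> 2"
proof -
  obtain w z where x: "x = (w, z)" by (cases x)
  have "\<bar>z\<bar> \<le> 1" "norm w \<le> 1" using assms by (auto simp: x cylinder_def)
  then have "z\<^sup>2 \<le> 1" "(norm w)\<^sup>2 \<le> 1"
    using power_mono [of "norm w" 1 2] by (auto simp: abs_square_le_1)
  then show ?thesis by (simp add: x norm_Pair)
qed

lemma is_chartE:
  assumes "is_chart \<phi>"
  obtains h g where "homeomorphism S3 S3 h g" "\<forall>x\<in>cylinder. \<phi> x = h (from_space x)"
  using assms unfolding is_chart_def ambient_isotopy_def by (metis atLeastAtMost_iff order_refl zero_le_one)

lemma chart_S3: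
  assumes "is_chart \<phi>" "x \<in> cylinder"
  shows "\<phi> x \<in> S3"
  using assms by (metis is_chartE from_space_S3 homeomorphism_image1 imageI)

lemma inj_on_chart:
  assumes "is_chart \<phi>"
  shows "inj_on \<phi> cylinder"
proof -
  obtain h g where h: "homeomorphism S3 S3 h g" and \<phi>: "\<forall>x\<in>cylinder. \<phi> x = h (from_space x)"
    by (rule is_chartE [OF assms])
  show ?thesis
    by (rule inj_on_inverseI [of _ "\<lambda>p. to_space (g p)"]) (simp add: \<phi> homeomorphism_apply1 [OF h])
qed

text \<open>On the cylinder a chart is \<open>from_space\<close> followed by a homeomorphism h of
  the sphere, so a motion supported in the cylinder can be lifted and conjugated by h. The parameter
  set T serves two uses: an interval for isotopies, a single point for one map that need not be
  injective.\<close>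

lemma chart_transport:
  fixes G :: "'b::metric_space \<Rightarrow> space \<Rightarrow> space"
  assumes chart: "is_chart \<phi>"
    and cont: "continuous_on (T \<times> UNIV) (\<lambda>(t, x). G t x)"
    and supp: "\<And>t x. t \<in> T \<Longrightarrow> x \<notin> cylinder \<Longrightarrow> G t x = x"
  obtains h g where "homeomorphism S3 S3 h g"
    and "continuous_on (T \<times> S3) (\<lambda>(t, p). h (lift (G t) (g p)))"
    and "\<And>t p. p \<in> S3 \<Longrightarrow> h (lift (G t) (g p)) \<in> S3"
    and "\<And>t x. x \<in> cylinder \<Longrightarrow> G t x \<in> cylinder \<Longrightarrow> h (lift (G t) (g (\<phi> x))) = \<phi> (G t x)"
    and "\<And>t p. t \<in> T \<Longrightarrow> p \<in> S3 \<Longrightarrow> p \<notin> \<phi> ` cylinder \<Longrightarrow> h (lift (G t) (g p)) = p"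
    and "\<And>t x. t \<in> T \<Longrightarrow> (norm x)\<^sup>2 + 1 \<le> 3 * ((norm (G t x))\<^sup>2 + 1)"
proof -
  obtain h g where h: "homeomorphism S3 S3 h g" and \<phi>: "\<forall>x\<in>cylinder. \<phi> x = h (from_space x)"
    by (rule is_chartE [OF chart])
  \<comment> \<open>In the cylinder the squared norm is at most 2, whence the constant 3; outside it
    x is fixed.\<close>
  have growth: "(norm x)\<^sup>2 + 1 \<le> 3 * ((norm (G t x))\<^sup>2 + 1)" if "t \<in> T" for t x
  proof (cases "x \<in> cylinder")
    case True
    have "3 * ((norm (G t x))\<^sup>2 + 1) \<ge> 3" by simp
    with cylinder_norm [OF True] show ?thesis by linarith
  next
    case False
    then show ?thesis using supp [OF that False] by (simp add: add_increasing)
  qed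
  have gS3: "g p \<in> S3" if "p \<in> S3" for p
    using homeomorphism_image2 [OF h] that by blast
  have "continuous_on (T \<times> S3) (\<lambda>x. h ((\<lambda>(t, p). lift (G t) p) (fst x, g (snd x))))"
  proof (rule continuous_on_compose2 [OF homeomorphism_cont1 [OF h]])
    show "continuous_on (T \<times> S3) (\<lambda>x. (\<lambda>(t, p). lift (G t) p) (fst x, g (snd x)))"
    proof (rule continuous_on_compose2 [OF continuous_lift [OF cont growth]])
      show "continuous_on (T \<times> S3) (\<lambda>x. (fst x, g (snd x)))"
        by (intro continuous_on_Pair continuous_on_fst continuous_on_id
            continuous_on_compose2 [OF homeomorphism_cont2 [OF h] continuous_on_snd [OF continuous_on_id]]) auto
    qed (auto intro: gS3)
  qed (auto intro: lift_S3)
  moreover have "h (lift (G t) (g p)) \<in> S3" for t p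
    using homeomorphism_image1 [OF h] lift_S3 by blast
  moreover have "h (lift (G t) (g (\<phi> x))) = \<phi> (G t x)" if "x \<in> cylinder" "G t x \<in> cylinder" for t x
    using that by (simp add: \<phi> homeomorphism_apply1 [OF h])
  moreover have "h (lift (G t) (g p)) = p" if "t \<in> T" "p \<in> S3" "p \<notin> \<phi> ` cylinder" for t p
  proof (cases "g p = north")
    case True
    then show ?thesis using homeomorphism_apply2 [OF h] that by (simp add: lift_def) metis
  next
    case False
    have "to_space (g p) \<notin> cylinder"
    proof
      assume "to_space (g p) \<in> cylinder"
      then have "\<phi> (to_space (g p)) = p"
        using False gS3 that(2) by (simp add: \<phi> homeomorphism_apply2 [OF h])
      then show False using \<open>to_space (g p) \<in> cylinder\<close> that(3) by (metis imageI)
    qed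
    then show ?thesis
      using False gS3 that by (simp add: lift_def supp homeomorphism_apply2 [OF h])
  qed
  ultimately show thesis
    using h growth by (intro that [of h g]) (auto simp: case_prod_unfold)
qed

text \<open>The value at \<open>\<phi> x\<close> is prescribed only when \<open>g x\<close> stays in
  the cylinder, because outside it a chart is arbitrary.\<close>

definition acts_in_chart :: "(space \<Rightarrow> point) \<Rightarrow> (space \<Rightarrow> space) \<Rightarrow> (point \<Rightarrow> point) \<Rightarrow> bool" where
  "acts_in_chart \<phi> g \<Gamma> \<longleftrightarrow>
     (\<forall>x\<in>cylinder. g x \<in> cylinder \<longrightarrow> \<Gamma> (\<phi> x) = \<phi> (g x)) \<and> (\<forall>p\<in>S3. p \<notin> \<phi> ` cylinder \<longrightarrow> \<Gamma> p = p)"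

lemma acts_in_chart_continuous:
  assumes chart: "is_chart \<phi>"
    and cont: "continuous_on UNIV g"
    and supp: "\<And>x. x \<notin> cylinder \<Longrightarrow> g x = x"
  obtains \<Gamma> where "acts_in_chart \<phi> g \<Gamma>" "continuous_on S3 \<Gamma>" "\<And>p. p \<in> S3 \<Longrightarrow> \<Gamma> p \<in> S3"
proof -
  have "continuous_on ({0::real} \<times> UNIV) (\<lambda>x. g (snd x))"
    by (intro continuous_on_compose2 [OF cont continuous_on_snd [OF continuous_on_id]]) auto
  then have "continuous_on ({0::real} \<times> UNIV) (\<lambda>(t, x). g x)"
    by (simp add: case_prod_unfold)
  then obtain h f where hf: "homeomorphism S3 S3 h f"
      "continuous_on ({0::real} \<times> S3) (\<lambda>(t, p). h (lift g (f p)))"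
      "\<And>p. p \<in> S3 \<Longrightarrow> h (lift g (f p)) \<in> S3"
      "\<And>x. x \<in> cylinder \<Longrightarrow> g x \<in> cylinder \<Longrightarrow> h (lift g (f (\<phi> x))) = \<phi> (g x)"
      "\<And>p. p \<in> S3 \<Longrightarrow> p \<notin> \<phi> ` cylinder \<Longrightarrow> h (lift g (f p)) = p"
    by (rule chart_transport [OF chart, of "{0}" "\<lambda>_. g"]) (use supp in auto)
  have "continuous_on S3 (\<lambda>p. (\<lambda>(t, p). h (lift g (f p))) (0 :: real, p))"
    by (rule continuous_on_compose2 [OF hf(2)]) (auto intro!: continuous_intros)
  then show thesis
    using hf by (intro that [of "\<lambda>p. h (lift g (f p))"]) (auto simp: acts_in_chart_def)
qed

lemma acts_in_chart_isotopy:
  fixes G :: "real \<Rightarrow> space \<Rightarrow> space"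
  assumes chart: "is_chart \<phi>"
    and cont: "continuous_on ({0..1} \<times> UNIV) (\<lambda>(t, x). G t x)"
    and supp: "\<And>t x. t \<in> {0..1} \<Longrightarrow> x \<notin> cylinder \<Longrightarrow> G t x = x"
    and bij: "\<And>t. t \<in> {0..1} \<Longrightarrow> bij (G t)"
    and id: "\<And>x. G 0 x = x"
  obtains H where "ambient_isotopy H" "acts_in_chart \<phi> (G 1) (H 1)"
proof -
  obtain h f where hf: "homeomorphism S3 S3 h f"
      "\<And>t x. x \<in> cylinder \<Longrightarrow> G t x \<in> cylinder \<Longrightarrow> h (lift (G t) (f (\<phi> x))) = \<phi> (G t x)"
      "\<And>t p. t \<in> {0..1} \<Longrightarrow> p \<in> S3 \<Longrightarrow> p \<notin> \<phi> ` cylinder \<Longrightarrow> h (lift (G t) (f p)) = p"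
      "\<And>t x. t \<in> {0..1} \<Longrightarrow> (norm x)\<^sup>2 + 1 \<le> 3 * ((norm (G t x))\<^sup>2 + 1)"
    by (rule chart_transport [OF chart cont]) (use supp in auto)
  have "ambient_isotopy (\<lambda>t p. h (lift (G t) (f p)))"
    by (intro ambient_isotopy_conj [OF hf(1)] ambient_isotopy_lift [OF cont hf(4) bij id]) auto
  then show thesis
    using hf by (intro that [of "\<lambda>t p. h (lift (G t) (f p))"]) (auto simp: acts_in_chart_def)
qed

section \<open>Smaller charts around a crossing\<close>

lemma is_chart_subchart:
  assumes \<phi>: "is_chart \<phi>" and A: "ambient_isotopy (\<lambda>t. lift (A t))"
    and sub: "\<And>x. x \<in> cylinder \<Longrightarrow> A 1 x \<in> cylinder"
  shows "is_chart (\<lambda>x. \<phi> (A 1 x))"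
proof -
  obtain H where H: "ambient_isotopy H" "\<And>x. x \<in> cylinder \<Longrightarrow> \<phi> x = H 1 (from_space x)"
    using \<phi> by (auto simp: is_chart_def)
  then show ?thesis
    unfolding is_chart_def using sub
    by (intro exI [of _ "\<lambda>t p. H t (lift (A t) p)"] conjI ambient_isotopy_comp [OF H(1) A]) auto
qed

text \<open>Strand 2 of \<open>crossing\<close> lies at \<open>1/2 - u\<close> over height u. The
  shear by \<open>u - 1/2\<close> moves it to 0, hence onto the vertical line over base point 1,
  that is, onto the first strand of the ball. Multiplication by \<open>\<i> * b\<close> with b = 1/4
  or b = - 1/4 then turns strand 1 of \<open>crossing\<close> into a half turn around that
  line.\<close>

definition subcylinder :: "real \<Rightarrow> real \<Rightarrow> real \<Rightarrow> space \<Rightarrow> space" where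
  "subcylinder b z\<^sub>0 \<epsilon> x = (base_point 1 + \<i> * of_real b * (fst x + of_real (snd x) - 1/2), z\<^sub>0 + \<epsilon> * snd x)"

lemma base_point_simps [simp]:
  "base_point 1 = - 1/2" "base_point (Suc 0) = - 1/2" "base_point 2 = 0" "base_point 3 = 1/2"
  by (simp_all add: base_point_def)

lemma subcylinder_in_cylinder:
  assumes x: "x \<in> cylinder" and b: "\<bar>b\<bar> \<le> 1/4" and z: "0 \<le> z\<^sub>0" "0 < \<epsilon>" "z\<^sub>0 + \<epsilon> \<le> 1"
  shows "subcylinder b z\<^sub>0 \<epsilon> x \<in> cylinder" 
    and "norm (fst (subcylinder b z\<^sub>0 \<epsilon> x) - base_point 1) \<le> 3/8"
    and "z\<^sub>0 \<le> snd (subcylinder b z\<^sub>0 \<epsilon> x)" "snd (subcylinder b z\<^sub>0 \<epsilon> x) \<le> z\<^sub>0 + \<epsilon>"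
proof -
  obtain w u where wu: "x = (w, u)" "norm w \<le> 1" "0 \<le> u" "u \<le> 1"
    using x by (auto simp: cylinder_def)
  \<comment> \<open>The sheared point has norm at most 1 + 1/2, which gives the radius 3/8; it is
    less than 1/2, the distance from base point 1 to base point 2.\<close>
  have "norm (w + of_real u - 1/2) \<le> norm w + norm (of_real (u - 1/2) :: complex)"
    using norm_triangle_ineq [of w "of_real (u - 1/2)"] by (simp add: algebra_simps)
  also have "\<dots> \<le> 3/2" unfolding norm_of_real using wu by linarith
  finally have "\<bar>b\<bar> * norm (w + of_real u - 1/2) \<le> 1/4 * (3/2)"
    using b by (intro mult_mono) auto
  then show *: "norm (fst (subcylinder b z\<^sub>0 \<epsilon> x) - base_point 1) \<le> 3/8"
    by (simp add: wu subcylinder_def norm_mult)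
  show "z\<^sub>0 \<le> snd (subcylinder b z\<^sub>0 \<epsilon> x)" "snd (subcylinder b z\<^sub>0 \<epsilon> x) \<le> z\<^sub>0 + \<epsilon>"
    using wu z by (auto simp: subcylinder_def mult_left_le)
  moreover have "norm (fst (subcylinder b z\<^sub>0 \<epsilon> x)) \<le> 1"
    using * norm_triangle_ineq [of "fst (subcylinder b z\<^sub>0 \<epsilon> x) - base_point 1" "base_point 1"] by simp
  ultimately show "subcylinder b z\<^sub>0 \<epsilon> x \<in> cylinder"
    using z by (auto simp: cylinder_def mem_Times_iff)
qed

text \<open>The straight-line interpolation from the identity works: its linear part in the disc
  direction is \<open>l t\<close>, whose real part \<open>1 - t\<close> is bounded below for t \<le>
  1/2 and whose imaginary part \<open>t * b\<close> is bounded below afterwards, and its height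
  factor \<open>m t\<close> is at least \<epsilon>. These lower bounds give bijectivity as well as
  growth.\<close>

lemma ambient_isotopy_subcylinder:
  assumes b: "b \<noteq> 0" "\<bar>b\<bar> \<le> 1" and \<epsilon>: "0 < \<epsilon>" "\<epsilon> \<le> 1"
  shows "ambient_isotopy (\<lambda>t. lift (\<lambda>x. (1 - t) *\<^sub>R x + t *\<^sub>R subcylinder b z\<^sub>0 \<epsilon> x))"
proof -
  define l :: "real \<Rightarrow> complex" where "l t = Complex (1 - t) (t * b)" for t
  define m :: "real \<Rightarrow> real" where "m t = 1 - t + t * \<epsilon>" for t
  define c :: "real \<Rightarrow> real \<Rightarrow> complex" where "c t z = of_real t * (\<i> * of_real b * (of_real z - 1/2) - 1/2)" for t z
  define G where "G = (\<lambda>t x. (1 - t) *\<^sub>R x + t *\<^sub>R subcylinder b z\<^sub>0 \<epsilon> x)"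
  have G: "G t (w, z) = (l t * w + c t z, m t * z + t * z\<^sub>0)" for t w z
    by (simp add: G_def subcylinder_def l_def c_def m_def complex_eq_iff algebra_simps)
  have m: "m t \<ge> \<epsilon>" if "t \<in> {0..1}" for t
    using that \<epsilon> mult_left_mono [of "\<epsilon>" 1 "1 - t"] by (simp add: m_def algebra_simps)
  have l: "norm (l t) \<ge> \<bar>b\<bar> / 2" if "t \<in> {0..1}" for t
  proof (cases "t \<le> 1/2")
    case True
    then have "\<bar>b\<bar> / 2 \<le> \<bar>Re (l t)\<bar>" using b by (simp add: l_def)
    then show ?thesis using abs_Re_le_cmod [of "l t"] by linarith
  next
    case False
    then have "1/2 * \<bar>b\<bar> \<le> t * \<bar>b\<bar>" by (intro mult_right_mono) auto
    then have "\<bar>b\<bar> / 2 \<le> \<bar>Im (l t)\<bar>" using False by (simp add: l_def abs_mult)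
    then show ?thesis using abs_Im_le_cmod [of "l t"] by linarith
  qed
  have l0: "l t \<noteq> 0" and m0: "m t \<noteq> 0" if "t \<in> {0..1}" for t
    using l [OF that] m [OF that] b \<epsilon> by auto
  \<comment> \<open>The sum of the bounds derived below for the disc coordinate and for the
    height.\<close>
  define C where "C = 2 / \<bar>b\<bar> * (2 + (1 + \<bar>z\<^sub>0\<bar>) / \<epsilon>) + (1 + \<bar>z\<^sub>0\<bar>) / \<epsilon>"
  have bound: "norm x \<le> C * (norm (G t x) + 1)" if t: "t \<in> {0..1}" for t x
  proof -
    obtain w z where x: "x = (w, z)" by (cases x)
    define n where "n = norm (G t x) + 1"
    have n: "norm (l t * w + c t z) \<le> n" "\<bar>m t * z + t * z\<^sub>0\<bar> \<le> n" "n \<ge> 1"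
      using norm_fst_le [of "l t * w + c t z" "m t * z + t * z\<^sub>0"]
        norm_snd_le [of "m t * z + t * z\<^sub>0" "l t * w + c t z"]
      by (auto simp: n_def x G)
    have tz: "\<bar>t * z\<^sub>0\<bar> \<le> \<bar>z\<^sub>0\<bar>" using t by (simp add: abs_mult mult_left_le_one_le)
    have "\<epsilon> * \<bar>z\<bar> \<le> \<bar>m t * z\<bar>"
      using m [OF t] \<epsilon> by (simp add: abs_mult mult_right_mono)
    also have "\<dots> \<le> n + \<bar>z\<^sub>0\<bar>" using n tz by linarith
    also have "\<dots> \<le> (1 + \<bar>z\<^sub>0\<bar>) * n" using n mult_left_mono [of 1 n "\<bar>z\<^sub>0\<bar>"] by (simp add: algebra_simps)
    finally have z: "\<bar>z\<bar> \<le> (1 + \<bar>z\<^sub>0\<bar>) / \<epsilon> * n" using \<epsilon> by (simp add: field_simps)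
    have "norm (c t z) \<le> 1 * (norm (\<i> * of_real b * (of_real z - 1/2)) + norm (1/2 :: complex))"
      unfolding c_def norm_mult [of "of_real t"] using t by (intro mult_mono norm_triangle_ineq4) auto
    also have "norm (\<i> * of_real b * (of_real z - 1/2)) \<le> 1 * norm (of_real (z - 1/2) :: complex)"
      unfolding norm_mult using b by (intro mult_mono) auto
    also have "\<dots> \<le> \<bar>z\<bar> + 1/2"
      unfolding norm_of_real using abs_triangle_ineq4 [of z "1/2"] by simp
    finally have c: "norm (c t z) \<le> \<bar>z\<bar> + 1" by simp
    have "\<bar>b\<bar> / 2 * norm w \<le> norm (l t * w)"
      unfolding norm_mult by (intro mult_right_mono l t norm_ge_zero)
    also have "\<dots> \<le> n + (\<bar>z\<bar> + 1)"
      using n c norm_triangle_ineq4 [of "l t * w + c t z" "c t z"] by simp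
    also have "\<dots> \<le> (2 + (1 + \<bar>z\<^sub>0\<bar>) / \<epsilon>) * n" using n z by (simp add: algebra_simps)
    finally have "norm w \<le> 2 / \<bar>b\<bar> * (2 + (1 + \<bar>z\<^sub>0\<bar>) / \<epsilon>) * n" using b by (simp add: field_simps)
    moreover have "norm x \<le> norm w + \<bar>z\<bar>"
      by (simp add: x norm_Pair sqrt_sum_squares_le_sum_abs [of "norm w" z, simplified])
    ultimately show ?thesis
      using z by (simp add: C_def n_def algebra_simps)
  qed
  have "ambient_isotopy (\<lambda>t. lift (G t))"
  proof (rule ambient_isotopy_lift)
    show "continuous_on ({0..1} \<times> UNIV) (\<lambda>(t, x). G t x)"
      unfolding G_def subcylinder_def case_prod_unfold by (intro continuous_intros)
    show "(norm x)\<^sup>2 + 1 \<le> (2 * C\<^sup>2 + 1) * ((norm (G t x))\<^sup>2 + 1)" if "t \<in> {0..1}" for t x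
      by (rule growth_of_affine_bound [OF bound [OF that]])
    show "bij (G t)" if "t \<in> {0..1}" for t
      \<comment> \<open>The equations are triangular: the height is recovered first, then the disc
        coordinate.\<close>
      by (rule bij_betw_byWitness [where f' = "\<lambda>(y, v). let z = (v - t * z\<^sub>0) / m t in ((y - c t z) / l t, z)"])
        (use l0 [OF that] m0 [OF that] in \<open>auto simp: G Let_def\<close>)
  qed (simp add: G_def)
  then show ?thesis by (simp only: G_def)
qed

lemma is_chart_subcylinder:
  assumes "is_chart \<phi>" and b: "b \<noteq> 0" "\<bar>b\<bar> \<le> 1/4" and z: "0 \<le> z\<^sub>0" "0 < \<epsilon>" "z\<^sub>0 + \<epsilon> \<le> 1"
  shows "is_chart (\<lambda>x. \<phi> (subcylinder b z\<^sub>0 \<epsilon> x))"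
proof -
  have "ambient_isotopy (\<lambda>t. lift (\<lambda>x. (1 - t) *\<^sub>R x + t *\<^sub>R subcylinder b z\<^sub>0 \<epsilon> x))"
    by (rule ambient_isotopy_subcylinder) (use b z in auto)
  from is_chart_subchart [OF assms(1) this] show ?thesis
    using subcylinder_in_cylinder(1) [OF _ b(2) z] by simp
qed

text \<open>The displacement is Lipschitz with constant \<open>norm v / \<delta>\<close> < 1.
  Solving for a preimage is therefore a contraction fixed point problem, and a perturbation of the
  identity by a contraction is injective.\<close>

lemma bij_push:
  fixes a v :: "'a::banach"
  assumes v: "norm v < \<delta>"
  shows "bij (\<lambda>w. w + max 0 (1 - norm (w - a) / \<delta>) *\<^sub>R v)"
proof -
  have \<delta>: "\<delta> > 0" using v norm_ge_zero [of v] by linarith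
  let ?b = "\<lambda>w. max 0 (1 - norm (w - a) / \<delta>)"
  have lip: "norm (?b w *\<^sub>R v - ?b w' *\<^sub>R v) \<le> norm v / \<delta> * norm (w - w')" for w w'
  proof -
    have "\<bar>?b w - ?b w'\<bar> \<le> \<bar>norm (w - a) / \<delta> - norm (w' - a) / \<delta>\<bar>" by linarith
    also have "\<dots> = \<bar>norm (w - a) - norm (w' - a)\<bar> / \<delta>"
      using \<delta> by (simp flip: diff_divide_distrib)
    also have "\<dots> \<le> norm (w - w') / \<delta>"
      using \<delta> norm_triangle_ineq3 [of "w - a" "w' - a"] by (simp add: divide_right_mono)
    finally have "\<bar>?b w - ?b w'\<bar> * norm v \<le> norm (w - w') / \<delta> * norm v"
      by (rule mult_right_mono) simp
    then show ?thesis by (simp flip: scaleR_left_diff_distrib add: mult.commute)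
  qed
  have c: "0 \<le> norm v / \<delta>" "norm v / \<delta> < 1" using v \<delta> by auto
  show ?thesis
  proof (rule bijI')
    show "\<exists>w. y = w + ?b w *\<^sub>R v" for y
    proof -
      have "dist (y - ?b w *\<^sub>R v) (y - ?b w' *\<^sub>R v) \<le> norm v / \<delta> * dist w w'" for w w'
        using lip [of w' w] by (simp add: dist_norm norm_minus_commute)
      then obtain w where "y - ?b w *\<^sub>R v = w"
        using banach_fix_type [OF c, of "\<lambda>w. y - ?b w *\<^sub>R v"] by blast
      then show ?thesis by (metis diff_add_cancel)
    qed
    show "(w + ?b w *\<^sub>R v = w' + ?b w' *\<^sub>R v) = (w = w')" for w w'
    proof
      assume "w + ?b w *\<^sub>R v = w' + ?b w' *\<^sub>R v"
      then have "w - w' = ?b w' *\<^sub>R v - ?b w *\<^sub>R v" by (simp add: algebra_simps)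
      then have "norm (w - w') \<le> norm v / \<delta> * norm (w - w')"
        using lip [of w' w] by (metis norm_minus_commute)
      then have "norm (w - w') * (1 - norm v / \<delta>) \<le> 0" by (simp add: algebra_simps)
      then show "w = w'" using c by (simp add: mult_le_0_iff)
    qed simp
  qed
qed

section \<open>The third strand in the punctured disc and its small pushes\<close>

definition third_strand :: "(real \<Rightarrow> complex) \<Rightarrow> strands" where
  "third_strand \<gamma> = trivial_strands(3 := \<gamma>)"

definition disc :: "complex set" where
  "disc = ball 0 1 - {base_point 1, base_point 2}"

lemma third_strand_simps [simp]:
  "third_strand \<gamma> 3 = \<gamma>" "r \<noteq> 3 \<Longrightarrow> third_strand \<gamma> r z = base_point r"
  by (simp_all add: third_strand_def trivial_strands_def)

lemma open_disc: "open disc"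
  unfolding disc_def by (intro open_Diff open_ball finite_imp_closed) auto

lemma norm_third_strand_le_1:
  assumes "r \<in> {1..3}" "norm (\<gamma> z) \<le> 1"
  shows "norm (third_strand \<gamma> r z) \<le> 1"
proof -
  have "r = 1 \<or> r = 2 \<or> r = 3" using assms(1) by auto
  then show ?thesis using assms(2) by auto
qed

lemma path_image_disc_norm: "path_image \<gamma> \<subseteq> disc \<Longrightarrow> z \<in> {0..1} \<Longrightarrow> norm (\<gamma> z) \<le> 1"
  unfolding path_image_def disc_def by (force simp: image_subset_iff)

text \<open>Extends a path constantly to all heights, so that a map built from it is continuous on
  all of 3-space; above and below the cylinder only the endpoints of the path matter.\<close>

definition clamp01 :: "real \<Rightarrow> real" where
  "clamp01 z = max 0 (min 1 z)"

lemma clamp01: "clamp01 z \<in> {0..1}" "z \<in> {0..1} \<Longrightarrow> clamp01 z = z" "z \<le> 0 \<Longrightarrow> clamp01 z = 0" "z \<ge> 1 \<Longrightarrow> clamp01 z = 1"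
  by (auto simp: clamp01_def)

lemma continuous_clamp01:
  assumes "path f"
  shows "continuous_on UNIV (\<lambda>z. f (clamp01 z))"
  using assms unfolding path_def
  by (rule continuous_on_compose2) (auto simp: clamp01 clamp01_def intro!: continuous_intros)

lemma not_in_cylinder_cases:
  assumes "(w, z) \<notin> cylinder"
  obtains "norm w > 1" | "z < 0" | "z > 1"
  using assms by (force simp: cylinder_def)

text \<open>On each level the push translates towards the new strand, damped by a cone-shaped bump
  of radius \<delta> about the old one. At the centre the bump is 1, so a is carried onto b;
  displacements below \<delta> make each level map bijective; equal endpoints make the push trivial
  above and below the cylinder.\<close>

lemma third_strand_push:
  assumes chart: "is_chart \<phi>" and a: "path a" and b: "path b"
    and ends: "pathstart b = pathstart a" "pathfinish b = pathfinish a"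
    and ball: "\<And>z. z \<in> {0..1} \<Longrightarrow> ball (a z) \<delta> \<subseteq> disc"
    and near: "\<And>z. z \<in> {0..1} \<Longrightarrow> dist (a z) (b z) < \<delta>"
  obtains H g where "ambient_isotopy H" "acts_in_chart \<phi> g (H 1)"
    "\<And>r z. r \<in> {1..3} \<Longrightarrow> z \<in> {0..1} \<Longrightarrow> g (third_strand a r z, z) = (third_strand b r z, z)"
proof -
  have \<delta>: "\<delta> > 0" using le_less_trans [OF zero_le_dist near [of 0]] by simp
  define A where "A z = a (clamp01 z)" for z
  define B where "B z = b (clamp01 z)" for z
  define G where "G t x = (fst x + max 0 (1 - norm (fst x - A (snd x)) / \<delta>) *\<^sub>R (t *\<^sub>R (B (snd x) - A (snd x))), snd x)"
    for t and x :: space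
  \<comment> \<open>The balls of radius \<delta> lie in \<open>disc\<close>, so the two punctures
    and all points outside the open unit disc are off the support of every bump.\<close>
  have far: "norm (p - A z) \<ge> \<delta>" if "p \<notin> disc" for p z
    using ball [of "clamp01 z"] that clamp01(1) [of z] unfolding A_def subset_iff mem_ball
    by (metis dist_commute dist_norm not_le)
  have contA: "continuous_on UNIV A" and contB: "continuous_on UNIV B"
    unfolding A_def B_def by (intro continuous_clamp01 a b)+
  have cont: "continuous_on ({0..1} \<times> UNIV) (\<lambda>(t, x). G t x)"
    unfolding G_def case_prod_unfold using \<delta>
    by (intro continuous_intros continuous_on_compose2 [OF contA] continuous_on_compose2 [OF contB]) auto
  have supp: "G t x = x" if "x \<notin> cylinder" for t x
  proof -
    obtain w z where x: "x = (w, z)" by (cases x)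
    from that [unfolded x] show ?thesis
    proof (cases rule: not_in_cylinder_cases)
      case 1
      then have "norm (w - A z) \<ge> \<delta>" by (intro far) (simp add: disc_def)
      then show ?thesis using \<delta> by (simp add: G_def x max_def)
    next
      case 2
      then show ?thesis using ends by (simp add: G_def x A_def B_def clamp01 pathstart_def)
    next
      case 3
      then show ?thesis using ends by (simp add: G_def x A_def B_def clamp01 pathfinish_def)
    qed
  qed
  \<comment> \<open>Heights are preserved, so the inverse is assembled from the inverses on the
    levels; its continuity comes from compactness of the sphere in
    \<open>ambient_isotopyI\<close>.\<close>
  have bij: "bij (G t)" if "t \<in> {0..1}" for t
  proof -
    define P where "P z w = w + max 0 (1 - norm (w - A z) / \<delta>) *\<^sub>R (t *\<^sub>R (B z - A z))" for z w
    have "bij (P z)" for z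
    proof -
      have "norm (t *\<^sub>R (B z - A z)) < \<delta>"
        using near [OF clamp01(1), of z] that mult_left_le_one_le [of "norm (B z - A z)" t]
        by (simp add: A_def B_def dist_norm norm_minus_commute)
      then show ?thesis unfolding P_def by (rule bij_push)
    qed
    then have P: "P z (inv (P z) w) = w" "inv (P z) (P z w) = w" for z w
      by (simp_all add: bij_is_surj bij_is_inj surj_f_inv_f)
    have G: "G t (w, z) = (P z w, z)" for w z by (simp add: G_def P_def)
    show ?thesis
      by (rule bij_betw_byWitness [where f' = "\<lambda>(w, z). (inv (P z) w, z)"]) (auto simp: G P)
  qed
  obtain H where H: "ambient_isotopy H" "acts_in_chart \<phi> (G 1) (H 1)"
    by (rule acts_in_chart_isotopy [OF chart cont supp bij]) (auto simp: G_def)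
  moreover have "G 1 (third_strand a r z, z) = (third_strand b r z, z)" if rz: "r \<in> {1..3}" "z \<in> {0..1}" for r z
  proof (cases "r = 3")
    case True
    then show ?thesis using rz by (simp add: G_def A_def B_def clamp01)
  next
    case False
    then have "r = 1 \<or> r = 2" using rz by auto
    then have "base_point r \<notin> disc" by (auto simp: disc_def)
    then show ?thesis using False far [of "base_point r" z] \<delta> by (simp add: G_def max_def)
  qed
  ultimately show thesis by (rule that)
qed

section \<open>Filling the balls of a Borromean singular link\<close>

text \<open>The case of \<open>isotopic\<close> in which parametrisations are carried along
  pointwise. All moves below have this form, and they are composed without
  reparametrisations.\<close>

definition ambient_isotopic :: "nat \<Rightarrow> point curves \<Rightarrow> point curves \<Rightarrow> bool" where
  "ambient_isotopic \<mu> L L' \<longleftrightarrow> (\<exists>H. ambient_isotopy H \<and> (\<forall>i<\<mu>. \<forall>t. H 1 (L i t) = L' i t))"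

lemma ambient_isotopy_const: "ambient_isotopy (\<lambda>t p. p)"
  unfolding ambient_isotopy_def case_prod_unfold
  by (auto intro!: continuous_intros exI [of _ "\<lambda>p. p"] simp: homeomorphism_def)

lemma ambient_isotopic_refl:
  assumes "\<And>i t. i < \<mu> \<Longrightarrow> L i t = L' i t"
  shows "ambient_isotopic \<mu> L L'"
  unfolding ambient_isotopic_def using assms ambient_isotopy_const by blast

lemma ambient_isotopic_trans:
  assumes "ambient_isotopic \<mu> L L'" "ambient_isotopic \<mu> L' L''"
  shows "ambient_isotopic \<mu> L L''"
proof -
  obtain H H' where "ambient_isotopy H" "ambient_isotopy H'"
    "\<forall>i<\<mu>. \<forall>t. H 1 (L i t) = L' i t" "\<forall>i<\<mu>. \<forall>t. H' 1 (L' i t) = L'' i t"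
    using assms unfolding ambient_isotopic_def by blast
  then show ?thesis
    unfolding ambient_isotopic_def by (intro exI [of _ "\<lambda>t p. H' t (H t p)"]) (simp add: ambient_isotopy_comp)
qed

lemma ambient_isotopic_imp_isotopic:
  assumes "ambient_isotopic \<mu> L L'"
  shows "isotopic \<mu> L L'"
  using assms unfolding ambient_isotopic_def isotopic_def
  by (elim exE, intro exI [of _ "\<lambda>i t. t"] exI) (auto simp: reparametrisation_def strict_mono_def)

lemma ambient_isotopic_isotopic_trans:
  assumes "ambient_isotopic \<mu> L L'" "isotopic \<mu> L' L''"
  shows "isotopic \<mu> L L''"
proof -
  obtain H H' \<theta> where "ambient_isotopy H" "ambient_isotopy H'"
    "\<forall>i<\<mu>. \<forall>t. H 1 (L i t) = L' i t"
    "\<forall>i<\<mu>. reparametrisation (\<theta> i) \<and> (\<forall>t. H' 1 (L' i t) = L'' i (\<theta> i t))"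
    using assms unfolding ambient_isotopic_def isotopic_def by blast
  then show ?thesis
    unfolding isotopic_def
    by (intro exI [of _ "\<lambda>t p. H' t (H t p)"] exI [of _ \<theta>]) (simp add: ambient_isotopy_comp)
qed

text \<open>The first isotopy carries closedness and embeddedness over to L'. The second leads from
  L' back to L and on to the smooth model K, so the linking numbers are those of the same K. Since
  homotopies are reversible, both isotopies are at hand without inverting an ambient
  isotopy.\<close>

lemma linking_class_ambient_isotopic:
  assumes iso: "ambient_isotopic \<mu> L L'" "ambient_isotopic \<mu> L' L" and L: "L \<in> linking_class \<mu> M"
  shows "L' \<in> linking_class \<mu> M"
proof -
  obtain K where K: "smooth_link \<mu> K" "isotopic \<mu> L (\<lambda>i t. from_space (K i t))"
      "\<forall>i<\<mu>. \<forall>j<\<mu>. i \<noteq> j \<longrightarrow> linking_number (K i) (K j) = of_int (M i j)"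
    using L unfolding linking_class_def by blast
  have K': "isotopic \<mu> L' (\<lambda>i t. from_space (K i t))"
    by (rule ambient_isotopic_isotopic_trans [OF iso(2) K(2)])
  obtain H where H: "ambient_isotopy H" "\<And>i t. i < \<mu> \<Longrightarrow> L' i t = H 1 (L i t)"
    using iso(1) unfolding ambient_isotopic_def by metis
  obtain g where g: "homeomorphism S3 S3 (H 1) g"
    using ambient_isotopyD(2) [OF H(1), of 1] by auto
  have L: "closed_curves \<mu> L" "embedded \<mu> L" "\<And>i t. i < \<mu> \<Longrightarrow> L i t \<in> S3"
    using L by (auto simp: linking_class_def link_def)
  have "closed_curves \<mu> L'"
    unfolding closed_curves_def
  proof (intro allI impI conjI)
    fix i assume i: "i < \<mu>"
    have "continuous_on UNIV (\<lambda>t. H 1 (L i t))"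
      using L i by (intro continuous_on_compose2 [OF homeomorphism_cont1 [OF g]]) (auto simp: closed_curves_def)
    then show "continuous_on UNIV (L' i)" using i by (simp add: H(2) [symmetric])
    show "L' i (t + 1) = L' i t" for t using L i by (simp add: H(2) closed_curves_def)
  qed
  moreover have "embedded \<mu> L'"
    unfolding embedded_def
  proof (intro allI impI)
    fix i j s t assume "i < \<mu>" "j < \<mu>" "L' i s = L' j t"
    then have "L i s = L j t" using homeomorphism_apply1 [OF g] L(3) by (metis H(2))
    then show "i = j \<and> s - t \<in> \<int>" using L(2) \<open>i < \<mu>\<close> \<open>j < \<mu>\<close> unfolding embedded_def by blast
  qed
  moreover have "range (L' i) \<subseteq> S3" if "i < \<mu>" for i
    unfolding image_subset_iff using that by (simp add: H(2) L(3) ambient_isotopyD(3) [OF H(1)])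
  ultimately show ?thesis
    using K K' by (auto simp: linking_class_def link_def)
qed

lemma periodic_int:
  assumes "closed_curves \<mu> L" "i < \<mu>" "t - s \<in> \<int>"
  shows "L i t = L i s"
proof -
  have per: "L i (x + real n) = L i x" for x n
    using assms(1,2) by (induction n) (auto simp: closed_curves_def add.assoc [symmetric] add.commute [of 1])
  obtain k where k: "t - s = of_int k" using assms(3) by (auto elim: Ints_cases)
  show ?thesis
  proof (cases "k \<ge> 0")
    case True
    then show ?thesis using per [of s "nat k"] k by (simp add: algebra_simps)
  next
    case False
    then have "s = t + real (nat (- k))" using k by simp
    then show ?thesis using per [of t "nat (- k)"] by simp
  qed
qed

lemma base_point_eq_iff [simp]: "base_point r = base_point r' \<longleftrightarrow> r = r'"
  by (simp add: base_point_def)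

lemma norm_base_point_le_1: "r \<in> {1..3} \<Longrightarrow> norm (base_point r) \<le> 1"
  using norm_third_strand_le_1 [of r "\<lambda>_. base_point 3" 0] by (cases "r = 3") auto

section \<open>Fillings of disjoint charted balls\<close>

locale triple_sites =
  fixes \<mu> d :: nat and S :: "nat sited_curves"
  assumes singular: "borromean_singular_link \<mu> d S"
begin

lemma
  shows closed: "closed_curves \<mu> (curve S)"
    and embedded: "embedded \<mu> (curve S)"
    and curve_S3: "i < \<mu> \<Longrightarrow> curve S i t \<in> S3"
    and chart: "k < d \<Longrightarrow> is_chart (chart S k)"
    and disjoint_balls: "k < d \<Longrightarrow> k' < d \<Longrightarrow> k \<noteq> k' \<Longrightarrow> chart S k ` cylinder \<inter> chart S k' ` cylinder = {}"
    and comp_less: "k < d \<Longrightarrow> r \<in> {1..3} \<Longrightarrow> comp S k r < \<mu>"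
    and par_continuous: "k < d \<Longrightarrow> r \<in> {1..3} \<Longrightarrow> continuous_on {0..1} (par S k r)"
    and par_mono: "k < d \<Longrightarrow> r \<in> {1..3} \<Longrightarrow> strict_mono_on {0..1} (par S k r)"
    and curve_par: "k < d \<Longrightarrow> r \<in> {1..3} \<Longrightarrow> z \<in> {0..1} \<Longrightarrow>
        curve S (comp S k r) (par S k r z) = chart S k (base_point r, z)"
    and in_ball: "k < d \<Longrightarrow> i < \<mu> \<Longrightarrow> curve S i t \<in> chart S k ` cylinder \<Longrightarrow> \<exists>r\<in>{1..3}. \<exists>z. at_site S k r z i t"
  using singular unfolding borromean_singular_link_def link_def sites_def trivial_strands_def
  by (simp_all add: image_subset_iff)

lemma disjoint:
  assumes "k < d" "k' < d" "chart S k x = chart S k' x'" "x \<in> cylinder" "x' \<in> cylinder"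
  shows "k = k'"
proof (rule ccontr)
  assume "k \<noteq> k'"
  from disjoint_balls [OF assms(1,2) this] have "chart S k x \<notin> chart S k' ` cylinder"
    using assms(4) by blast
  then show False using assms(3,5) by (metis imageI)
qed

lemma curve_at_site:
  assumes "k < d" "r \<in> {1..3}" "at_site S k r z i t"
  shows "i < \<mu>" "z \<in> {0..1}" "curve S i t = chart S k (base_point r, z)" "(base_point r, z) \<in> cylinder"
  using assms comp_less [OF assms(1,2)] curve_par [OF assms(1,2)] norm_base_point_le_1 [OF assms(2)]
    periodic_int [OF closed, of "comp S k r" t "par S k r z"]
  by (auto simp: at_site_def cylinder_def)

text \<open>Balls are disjoint, charts are injective on the cylinder and base points are distinct.
  This is what makes the description in \<open>fill\<close> well defined.\<close>

lemma site_unique: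
  assumes "k < d" "r \<in> {1..3}" "at_site S k r z i t" "k' < d" "r' \<in> {1..3}" "at_site S k' r' z' i t"
  shows "k' = k \<and> r' = r \<and> z' = z"
proof -
  note 1 = curve_at_site [OF assms(1-3)] and 2 = curve_at_site [OF assms(4-6)]
  have "k' = k" using 1 2 disjoint assms(1,4) by metis
  moreover from this have "(base_point r, z) = (base_point r', z')"
    using inj_onD [OF inj_on_chart [OF chart [OF assms(1)]]] 1 2 by metis
  ultimately show ?thesis by simp
qed

lemma fill_site:
  assumes "k < d" "r \<in> {1..3}" "at_site S k r z i t"
  shows "fill 3 {..<d} S F i t = chart S k (F k r z, z)"
proof -
  have the: "(\<exists>s\<in>{..<d}. \<exists>r\<in>{1..3}. \<exists>z. at_site S s r z i t \<and> p = chart S s (F s r z, z)) \<longleftrightarrow>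
      p = chart S k (F k r z, z)" (is "?P p \<longleftrightarrow> _") for p
  proof
    assume "?P p"
    then obtain k' r' z' where "k' < d" "r' \<in> {1..3}" "at_site S k' r' z' i t" "p = chart S k' (F k' r' z', z')"
      by blast
    with site_unique [OF assms] show "p = chart S k (F k r z, z)" by metis
  next
    assume "p = chart S k (F k r z, z)"
    then show "?P p" using assms by blast
  qed
  have "\<exists>s\<in>{..<d}. \<exists>r\<in>{1..3}. \<exists>z. at_site S s r z i t" using assms by blast
  then show ?thesis
    by (simp only: fill_def the if_True the_eq_trivial)
qed

lemma fill_no_site:
  assumes "\<And>k r z. k < d \<Longrightarrow> r \<in> {1..3} \<Longrightarrow> \<not> at_site S k r z i t"
  shows "fill 3 {..<d} S F i t = curve S i t"
  using assms unfolding fill_def by auto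

text \<open>The case distinction depends on the sited link and the parameter only, and in each case
  the equation holds for every F; hence two fillings can be compared within one case.\<close>

lemma fill_cases:
  obtains k r z where "k < d" "r \<in> {1..3}" "at_site S k r z i t" "z \<in> {0..1}"
      "\<And>F. fill 3 {..<d} S F i t = chart S k (F k r z, z)"
  | "\<And>k r z. k < d \<Longrightarrow> r \<in> {1..3} \<Longrightarrow> \<not> at_site S k r z i t"
      "\<And>k. k < d \<Longrightarrow> i < \<mu> \<Longrightarrow> curve S i t \<notin> chart S k ` cylinder"
      "\<And>F. fill 3 {..<d} S F i t = curve S i t"
  using fill_site fill_no_site in_ball curve_at_site(2) by metis

lemma fill_cong:
  assumes "\<And>k r z. k < d \<Longrightarrow> r \<in> {1..3} \<Longrightarrow> z \<in> {0..1} \<Longrightarrow> F k r z = F' k r z"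
  shows "fill 3 {..<d} S F i t = fill 3 {..<d} S F' i t"
  by (cases rule: fill_cases [of i t]) (auto simp: assms)

lemma fill_trivial:
  "fill 3 {..<d} S (\<lambda>k. trivial_strands) i t = curve S i t"
  by (cases rule: fill_cases [of i t]) (auto simp: trivial_strands_def curve_at_site)

definition strands_in_disc :: "(nat \<Rightarrow> strands) \<Rightarrow> bool" where
  "strands_in_disc F \<longleftrightarrow> (\<forall>k<d. \<forall>r\<in>{1..3}. \<forall>z\<in>{0..1}. norm (F k r z) \<le> 1)"

text \<open>A map acting in the ball k refills that ball. The strands in other balls, and the link
  outside all balls, lie where the map is the identity.\<close>

lemma fill_update:
  assumes k: "k < d" and i: "i < \<mu>" and \<Gamma>: "acts_in_chart (chart S k) g \<Gamma>"
    and g: "\<And>r z. r \<in> {1..3} \<Longrightarrow> z \<in> {0..1} \<Longrightarrow> g (F k r z, z) = (B r z, z)"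
    and F: "strands_in_disc F" and B: "\<And>r z. r \<in> {1..3} \<Longrightarrow> z \<in> {0..1} \<Longrightarrow> norm (B r z) \<le> 1"
  shows "\<Gamma> (fill 3 {..<d} S F i t) = fill 3 {..<d} S (F(k := B)) i t"
proof (cases rule: fill_cases [of i t])
  case (1 j r z)
  then have Fc: "(F j r z, z) \<in> cylinder"
    using F by (auto simp: cylinder_def strands_in_disc_def)
  show ?thesis
  proof (cases "j = k")
    case True
    have "(B r z, z) \<in> cylinder" using 1 B by (auto simp: cylinder_def)
    then show ?thesis using \<Gamma> 1 Fc True g by (simp add: acts_in_chart_def)
  next
    case False
    then have "chart S j (F j r z, z) \<notin> chart S k ` cylinder"
      using disjoint [OF 1(1) k _ Fc] by auto
    then show ?thesis
      using \<Gamma> 1 False chart_S3 [OF chart Fc] by (simp add: acts_in_chart_def)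
  qed
next
  case 2
  then show ?thesis using \<Gamma> k i curve_S3 by (simp add: acts_in_chart_def)
qed

lemma strands_in_disc_update:
  assumes "strands_in_disc F" "\<And>r z. r \<in> {1..3} \<Longrightarrow> z \<in> {0..1} \<Longrightarrow> norm (B r z) \<le> 1"
  shows "strands_in_disc (F(k := B))"
  using assms by (auto simp: strands_in_disc_def)

text \<open>The image of the homotopy is compact in the open set \<open>disc\<close>, so one
  \<delta> fits around all of its points; by uniform continuity the stages at times
  \<open>j / N\<close> are closer than \<delta> to their successors for large N. Each stage is then
  carried to the next by \<open>third_strand_push\<close>.\<close>

lemma fill_homotopic:
  assumes k: "k < d" and hom: "homotopic_paths disc a b" and F: "strands_in_disc F"
  shows "ambient_isotopic \<mu> (fill 3 {..<d} S (F(k := third_strand a))) (fill 3 {..<d} S (F(k := third_strand b)))"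
proof -
  obtain h :: "real \<times> real \<Rightarrow> complex" where h': "continuous_on ({0..1} \<times> {0..1}) h" "h \<in> ({0..1} \<times> {0..1}) \<rightarrow> disc"
      "\<forall>x\<in>{0..1}. h (0, x) = a x" "\<forall>x\<in>{0..1}. h (1, x) = b x"
      "\<forall>t\<in>{0..1}. pathstart (h \<circ> Pair t) = pathstart a \<and> pathfinish (h \<circ> Pair t) = pathfinish a"
    using hom unfolding homotopic_paths by blast
  then have h: "continuous_on ({0..1} \<times> {0..1}) h" "h ` ({0..1} \<times> {0..1}) \<subseteq> disc"
      "\<And>z. z \<in> {0..1} \<Longrightarrow> h (0, z) = a z" "\<And>z. z \<in> {0..1} \<Longrightarrow> h (1, z) = b z"
      "\<And>s. s \<in> {0..1} \<Longrightarrow> h (s, 0) = a 0" "\<And>s. s \<in> {0..1} \<Longrightarrow> h (s, 1) = a 1"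
    by (simp_all add: pathstart_def pathfinish_def image_subset_iff_funcset)
  let ?Q = "{0..1} \<times> {0..1} :: (real \<times> real) set"
  obtain \<delta> where \<delta>: "\<delta> > 0" "\<And>p. p \<in> h ` ?Q \<Longrightarrow> ball p \<delta> \<subseteq> disc"
  proof -
    have "compact (h ` ?Q)" by (intro compact_continuous_image h compact_Times) auto
    from compact_subset_open_imp_ball_epsilon_subset [OF this open_disc h(2)]
    obtain \<delta> where "\<delta> > 0" "(\<Union>p\<in>h ` ?Q. ball p \<delta>) \<subseteq> disc" by blast
    then show thesis by (intro that [of \<delta>]) auto
  qed
  have "uniformly_continuous_on ?Q h"
    by (intro compact_uniformly_continuous h compact_Times) auto
  then obtain \<eta> where \<eta>: "\<eta> > 0" "\<And>x y. x \<in> ?Q \<Longrightarrow> y \<in> ?Q \<Longrightarrow> dist x y < \<eta> \<Longrightarrow> dist (h x) (h y) < \<delta>"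
    using \<delta>(1) unfolding uniformly_continuous_on_def by (metis dist_commute)
  obtain N :: nat where N: "N > 0" "1 / real N < \<eta>"
    using \<eta>(1) by (metis nat_approx_posE of_nat_0_less_iff zero_less_Suc)
  define c where "c j z = h (real j / real N, z)" for j :: nat and z
  have jN: "real j / real N \<in> {0..1}" if "j \<le> N" for j using that N by auto
  have path_c: "path (c j)" if "j \<le> N" for j
    unfolding path_def c_def using jN [OF that]
    by (intro continuous_on_compose2 [OF h(1)]) (auto intro!: continuous_intros)
  have c_disc: "c j z \<in> h ` ?Q" if "j \<le> N" "z \<in> {0..1}" for j z
    unfolding c_def using jN [OF that(1)] that(2) by (intro imageI) auto
  then have c_norm: "norm (c j z) \<le> 1" if "j \<le> N" "z \<in> {0..1}" for j z
    using that h(2) by (fastforce simp: disc_def)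
  have sd: "norm (third_strand (c j) r z) \<le> 1" if "j \<le> N" "r \<in> {1..3}" "z \<in> {0..1}" for j r z
    by (rule norm_third_strand_le_1) (use that c_norm in auto)
  let ?L = "\<lambda>j. fill 3 {..<d} S (F(k := third_strand (c j)))"
  have "ambient_isotopic \<mu> (?L 0) (?L j)" if "j \<le> N" for j
    using that
  proof (induction j)
    case (Suc j)
    have near: "dist (c j z) (c (Suc j) z) < \<delta>" if "z \<in> {0..1}" for z
    proof -
      have "dist (real j / real N, z) (real (Suc j) / real N, z) < \<eta>"
      proof -
        have "real (Suc j) / real N = real j / real N + 1 / real N" by (simp add: add_divide_distrib)
        then show ?thesis using N(2) by (simp add: dist_Pair_Pair dist_real_def)
      qed
      then show ?thesis unfolding c_def
        using jN [of j] jN [of "Suc j"] Suc.prems that by (intro \<eta>(2)) auto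
    qed
    obtain H g where H: "ambient_isotopy H" "acts_in_chart (chart S k) g (H 1)"
      and g: "\<And>r z. r \<in> {1..3} \<Longrightarrow> z \<in> {0..1} \<Longrightarrow> g (third_strand (c j) r z, z) = (third_strand (c (Suc j)) r z, z)"
    proof (rule third_strand_push [OF chart [OF k]])
      show "path (c j)" "path (c (Suc j))" using path_c Suc.prems by auto
      show "pathstart (c (Suc j)) = pathstart (c j)" "pathfinish (c (Suc j)) = pathfinish (c j)"
        using h(5,6) jN [of j] jN [of "Suc j"] Suc.prems by (auto simp: c_def pathstart_def pathfinish_def)
      show "ball (c j z) \<delta> \<subseteq> disc" if "z \<in> {0..1}" for z
        using c_disc \<delta>(2) that Suc.prems by simp
    qed (use near in auto)
    have "ambient_isotopic \<mu> (?L j) (?L (Suc j))"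
      unfolding ambient_isotopic_def
    proof (intro exI conjI allI impI)
      show "H 1 (?L j i t) = ?L (Suc j) i t" if "i < \<mu>" for i t
        using fill_update [OF k that H(2), of "F(k := third_strand (c j))" "third_strand (c (Suc j))"]
          strands_in_disc_update [OF F sd] sd g Suc.prems by simp
    qed (rule H)
    then show ?case by (rule ambient_isotopic_trans [OF Suc.IH [OF Suc_leD [OF Suc.prems]]])
  qed (simp add: ambient_isotopic_refl)
  from this [of N] have "ambient_isotopic \<mu> (?L 0) (?L N)" by simp
  moreover have "?L 0 i t = fill 3 {..<d} S (F(k := third_strand a)) i t" for i t
    by (rule fill_cong) (simp add: third_strand_def c_def h)
  moreover have "?L N i t = fill 3 {..<d} S (F(k := third_strand b)) i t" for i t
    using N by (intro fill_cong) (simp add: third_strand_def c_def h)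
  ultimately show ?thesis by (simp add: ambient_isotopic_def)
qed

end

section \<open>Words of paths up to homotopy\<close>

fun chain :: "'a::topological_space set \<Rightarrow> 'a \<Rightarrow> (real \<Rightarrow> 'a) list \<Rightarrow> 'a \<Rightarrow> bool" where
  "chain X x [] y \<longleftrightarrow> x = y \<and> x \<in> X"
| "chain X x (p # ps) y \<longleftrightarrow> path p \<and> path_image p \<subseteq> X \<and> pathstart p = x \<and> chain X (pathfinish p) ps y"

fun joins :: "'a::real_normed_vector \<Rightarrow> (real \<Rightarrow> 'a) list \<Rightarrow> real \<Rightarrow> 'a" where
  "joins x [] = linepath x x"
| "joins x (p # ps) = p +++ joins (pathfinish p) ps"

lemma chain_append: "chain X x (ps @ qs) z \<longleftrightarrow> (\<exists>y. chain X x ps y \<and> chain X y qs z)"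
proof (induction ps arbitrary: x)
  case Nil
  have "x \<in> X" if "chain X x qs z" using that by (cases qs) auto
  then show ?case by auto
qed auto

lemma chain_in: "chain X x ps y \<Longrightarrow> x \<in> X" "chain X x ps y \<Longrightarrow> y \<in> X"
proof -
  show "chain X x ps y \<Longrightarrow> x \<in> X" by (cases ps) auto
  show "chain X x ps y \<Longrightarrow> y \<in> X" by (induction ps arbitrary: x) auto
qed

lemma chain_joins:
  assumes "chain X x ps y"
  shows "path (joins x ps)" "path_image (joins x ps) \<subseteq> X" "pathstart (joins x ps) = x" "pathfinish (joins x ps) = y"
proof -
  have "path (joins x ps) \<and> path_image (joins x ps) \<subseteq> X \<and> pathstart (joins x ps) = x \<and> pathfinish (joins x ps) = y"
    using assms by (induction ps arbitrary: x) (auto simp: path_image_join)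
  then show "path (joins x ps)" "path_image (joins x ps) \<subseteq> X" "pathstart (joins x ps) = x" "pathfinish (joins x ps) = y"
    by auto
qed

text \<open>
  Products with different bracketings have the same words, so homotopies are reduced to equality of
  lists.
\<close>

definition word ::
    "'a::real_normed_vector set \<Rightarrow> 'a \<Rightarrow> (real \<Rightarrow> 'a) \<Rightarrow> (real \<Rightarrow> 'a) list \<Rightarrow> 'a \<Rightarrow> bool" where
  "word X x p ps y \<longleftrightarrow> chain X x ps y \<and> homotopic_paths X p (joins x ps)"

lemma word_const: "x \<in> X \<Longrightarrow> word X x (linepath x x) [] x"
  by (simp add: word_def)

lemma word_path:
  assumes "path p" "path_image p \<subseteq> X"
  shows "word X (pathstart p) p [p] (pathfinish p)"
  using assms homotopic_paths_sym [OF homotopic_paths_rid [OF assms]]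
  by (auto simp: word_def pathfinish_in_path_image subset_iff)

lemma word_homotopic:
  assumes "word X x q ps y" "homotopic_paths X p q"
  shows "word X x p ps y"
  using assms homotopic_paths_trans by (auto simp: word_def)

lemma word_unique:
  assumes "word X x p ps y" "word X x q ps y"
  shows "homotopic_paths X p q"
  using assms homotopic_paths_trans homotopic_paths_sym unfolding word_def by blast

lemma word_ends:
  assumes "word X x p ps y"
  shows "path p" "path_image p \<subseteq> X" "pathstart p = x" "pathfinish p = y"
  using assms chain_joins homotopic_paths_imp_path homotopic_paths_imp_subset
    homotopic_paths_imp_pathstart homotopic_paths_imp_pathfinish
  unfolding word_def by metis+

lemma joins_append:
  assumes "chain X x ps y" "chain X y qs z"
  shows "homotopic_paths X (joins x ps +++ joins y qs) (joins x (ps @ qs))"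
  using assms
proof (induction ps arbitrary: x)
  case Nil
  then show ?case using chain_joins [of X y qs z] homotopic_paths_lid [of "joins y qs" X]
    by (simp add: linepath_refl)
next
  case (Cons p ps)
  note 1 = chain_joins [of X "pathfinish p" ps y] and 2 = chain_joins [of X y qs z]
  have "homotopic_paths X ((p +++ joins (pathfinish p) ps) +++ joins y qs) (p +++ (joins (pathfinish p) ps +++ joins y qs))"
    using Cons 1 2 by (intro homotopic_paths_sym [OF homotopic_paths_assoc]) auto
  moreover have "homotopic_paths X (p +++ (joins (pathfinish p) ps +++ joins y qs)) (p +++ joins (pathfinish p) (ps @ qs))"
    using Cons 1 2 by (intro homotopic_paths_join) auto
  ultimately show ?case by (auto intro: homotopic_paths_trans)
qed

lemma word_join:
  assumes p: "word X x p ps y" and q: "word X y q qs z"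
  shows "word X x (p +++ q) (ps @ qs) z"
proof -
  have "homotopic_paths X (p +++ q) (joins x ps +++ joins y qs)"
    using p q word_ends [OF p] word_ends [OF q] by (intro homotopic_paths_join) (auto simp: word_def)
  then show ?thesis
    using p q joins_append [of X x ps y qs z] homotopic_paths_trans
    unfolding word_def chain_append by blast
qed

lemma word_reverse:
  assumes "word X x p ps y"
  shows "word X y (reversepath p) (rev (map reversepath ps)) x"
proof -
  have "word X y (reversepath (joins x ps)) (rev (map reversepath ps)) x" if "chain X x ps y" for x ps
    using that
  proof (induction ps arbitrary: x)
    case (Cons p ps)
    have "reversepath (p +++ joins (pathfinish p) ps) = reversepath (joins (pathfinish p) ps) +++ reversepath p"
      using Cons.prems chain_joins [of X "pathfinish p" ps y] by (intro reversepath_joinpaths) auto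
    moreover have "word X (pathfinish p) (reversepath p) [reversepath p] x"
      using Cons.prems word_path [of "reversepath p" X] by auto
    ultimately show ?case using Cons by (auto intro: word_join)
  qed (simp add: word_const)
  moreover have "homotopic_paths X (reversepath p) (reversepath (joins x ps))"
    using assms homotopic_paths_reversepath_D unfolding word_def by blast
  ultimately show ?thesis using assms by (auto simp: word_def intro: homotopic_paths_trans)
qed

text \<open>The path \<open>a +++ reversepath a\<close> has both \<open>[a, reversepath a]\<close>
  and \<open>[]\<close> as words. In a product with the given word it can be read either way, and p
  is homotopic to that product.\<close>

lemma word_cancel:
  assumes w: "word X x p (ps @ a # reversepath a # qs) y"
  shows "word X x p (ps @ qs) y"
proof -
  obtain u where u: "chain X x ps u" "chain X u (a # reversepath a # qs) y"
    using w by (auto simp: word_def chain_append)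
  then have a: "path a" "path_image a \<subseteq> X" "pathstart a = u" and q: "chain X u qs y" by auto
  have aa: "homotopic_paths X (a +++ reversepath a) (linepath u u)"
    using homotopic_paths_rinv [OF a(1,2)] a(3) by simp
  have W: "word X u (joins u qs) qs y" "word X x (joins x ps) ps u"
    using q u by (auto simp: word_def chain_joins)
  have *: "word X u (a +++ reversepath a) [] u"
    using word_homotopic [OF word_const aa] a pathstart_in_path_image [of a] by blast
  have "word X u (a +++ reversepath a) [a, reversepath a] u"
    using word_join [OF word_path [OF a(1,2)], of "reversepath a" "[reversepath a]"] word_path [of "reversepath a" X] a by auto
  from word_join [OF W(2) word_join [OF this W(1)]]
  have "word X x (joins x ps +++ ((a +++ reversepath a) +++ joins u qs)) (ps @ a # reversepath a # qs) y" by simp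
  from word_unique [OF w this] word_join [OF W(2) word_join [OF * W(1)]]
  show ?thesis using word_homotopic by fastforce
qed

section \<open>The third strand of a clasp\<close>

text \<open>The image of strand 1 of \<open>crossing e\<close> under \<open>subcylinder\<close> with
  b = 1/4, hence the factor \<open>\<i> / 4\<close>. It runs from below base point 1 to above it, on
  the right for e = 1, on the left for e = - 1 and straight through it for e = 0.\<close>

definition half_turn :: "real \<Rightarrow> real \<Rightarrow> complex" where
  "half_turn e z = base_point 1 + \<i> / 4 * Complex (2 * z - 1) (- e * min z (1 - z))"

text \<open>
  \<open>two_crossings P Q R e\<close> below makes its half turns on the intervals \<open>[1/8, 1/4]\<close> and \<open>[1/2, 3/4]\<close>;
  \<open>True\<close> stands for the first one. The second half turn is run through backwards, so its crossing has
  the opposite sign and its chart is rotated by \<open>\<pi>\<close>.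
\<close>

definition site_lo :: "bool \<Rightarrow> real" where "site_lo p = (if p then 1/8 else 1/2)"
definition site_len :: "bool \<Rightarrow> real" where "site_len p = (if p then 1/8 else 1/4)"
definition site_sub :: "bool \<Rightarrow> space \<Rightarrow> space" where
  "site_sub p = subcylinder (if p then 1/4 else - 1/4) (site_lo p) (site_len p)"

lemma site_in_01: "z \<in> {0..1} \<Longrightarrow> site_lo p + site_len p * z \<in> {0..1}"
  by (auto simp: site_lo_def site_len_def)

lemma site_len_pos: "site_len p > 0"
  by (simp add: site_len_def)

lemma site_pos_unique:
  assumes "site_lo p + site_len p * z = site_lo p' + site_len p' * z'" "z \<in> {0..1}" "z' \<in> {0..1}"
  shows "p = p' \<and> z = z'"
  using assms by (auto simp: site_lo_def site_len_def split: if_splits)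

lemma site_sub_cylinder:
  assumes "x \<in> cylinder"
  shows "site_sub p x \<in> cylinder" "norm (fst (site_sub p x) - base_point 1) \<le> 3/8"
    "\<exists>z\<in>{0..1}. snd (site_sub p x) = site_lo p + site_len p * z"
proof -
  show "site_sub p x \<in> cylinder" "norm (fst (site_sub p x) - base_point 1) \<le> 3/8"
    unfolding site_sub_def site_lo_def site_len_def
    by (rule subcylinder_in_cylinder(1,2) [OF assms]; auto)+
  show "\<exists>z\<in>{0..1}. snd (site_sub p x) = site_lo p + site_len p * z"
    using assms by (intro bexI [of _ "snd x"]) (auto simp: site_sub_def subcylinder_def cylinder_def)
qed

text \<open>The bracketing fixes the times: P on [0, 1/8], the first half turn on [1/8, 1/4], Q on
  [1/4, 1/2], the second half turn on [1/2, 3/4], R on [3/4, 1]. The interval of Q separates the two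
  crossings.\<close>

definition two_crossings :: "(real \<Rightarrow> complex) \<Rightarrow> (real \<Rightarrow> complex) \<Rightarrow> (real \<Rightarrow> complex) \<Rightarrow> real \<Rightarrow> real \<Rightarrow> complex" where
  "two_crossings P Q R e = ((P +++ half_turn e) +++ Q) +++ (reversepath (half_turn e) +++ R)"

lemma half_turn_ends [simp]:
  "pathstart (half_turn e) = base_point 1 - \<i> / 4" "pathfinish (half_turn e) = base_point 1 + \<i> / 4"
  by (simp_all add: half_turn_def pathstart_def pathfinish_def complex_eq_iff)

lemma path_half_turn [simp]: "path (half_turn e)"
  unfolding half_turn_def path_def Complex_eq by (intro continuous_intros)

lemma half_turn_near:
  assumes "\<bar>e\<bar> \<le> 1" "z \<in> {0..1}"
  shows "norm (half_turn e z - base_point 1) \<le> 1/4"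
proof -
  \<comment> \<open>The sum of the absolute coordinates suffices:
    \<open>\<bar>2 * z - 1\<bar> + min z (1 - z)\<close> never exceeds 1 on the unit
    interval.\<close>
  have "norm (Complex (2 * z - 1) (- e * min z (1 - z))) \<le> \<bar>2 * z - 1\<bar> + \<bar>e\<bar> * min z (1 - z)"
    using cmod_le [of "Complex (2 * z - 1) (- e * min z (1 - z))"] assms by (simp add: abs_mult)
  also have "\<dots> \<le> \<bar>2 * z - 1\<bar> + 1 * min z (1 - z)"
    using assms by (intro add_left_mono mult_right_mono) auto
  also have "\<dots> \<le> 1" using assms by auto
  finally show ?thesis by (simp add: half_turn_def norm_mult)
qed

lemma near_base_point_1:
  assumes "norm (w - base_point 1) < 1/2"
  shows "norm w < 1" "w \<noteq> base_point 2"
  using assms norm_triangle_ineq [of "w - base_point 1" "base_point 1"] by auto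

lemma half_turn_eq_base_point_1:
  assumes "z \<in> {0..1}" "half_turn e z = base_point 1"
  shows "z = 1/2" "e = 0"
  using assms by (auto simp: half_turn_def complex_eq_iff)

lemma half_turn_disc: 
  assumes "\<bar>e\<bar> = 1" 
  shows "path_image (half_turn e) \<subseteq> disc"
proof -
  have "half_turn e z \<in> disc" if "z \<in> {0..1}" for z
    using half_turn_near [of e z] near_base_point_1 [of "half_turn e z"] half_turn_eq_base_point_1 [of z e] that assms
    by (auto simp: disc_def simp del: base_point_simps)
  then show ?thesis by (auto simp: path_image_def)
qed

text \<open>The shear turns the real part \<open>z - 1/2\<close> into \<open>2 * z - 1\<close>. For
  b = - 1/4 the rotation reverses the half turn in time; its bulge \<open>min z (1 - z)\<close> is
  symmetric in time and must be compensated by the sign of e.\<close>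

lemma site_sub_crossing_1:
  "site_sub p (crossing (if p then e else - e) 1 z, z) = (half_turn e (if p then z else 1 - z), site_lo p + site_len p * z)"
  by (cases p) (auto simp: site_sub_def subcylinder_def crossing_def half_turn_def complex_eq_iff min.commute field_simps)

lemma site_sub_crossing_2:
  "site_sub p (crossing e 2 z, z) = (base_point 1, site_lo p + site_len p * z)"
  by (simp add: site_sub_def subcylinder_def crossing_def complex_eq_iff)

lemma two_crossings_eq:
  "two_crossings P Q R e z =
    (if z \<le> 1/8 then P (8 * z) else if z \<le> 1/4 then half_turn e (8 * z - 1)
     else if z \<le> 1/2 then Q (4 * z - 1) else if z \<le> 3/4 then half_turn e (3 - 4 * z) else R (4 * z - 3))"
  by (simp add: two_crossings_def joinpaths_def reversepath_def algebra_simps)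

lemma two_crossings_site:
  assumes "pathfinish P = base_point 1 - \<i> / 4" "pathfinish Q = base_point 1 + \<i> / 4" "z \<in> {0..1}"
  shows "site_sub p (crossing (if p then e else - e) 1 z, z) =
    (two_crossings P Q R e (site_lo p + site_len p * z), site_lo p + site_len p * z)"
proof (cases p)
  case True
  \<comment> \<open>At the lower end of the site, time 1/8, \<open>two_crossings_eq\<close> selects
    P and not the half turn, so their common endpoint is needed. In the other case Q takes this part
    at time 1/2.\<close>
  have "P 1 = half_turn e 0"
    using assms(1) half_turn_ends(1) [of e] by (simp only: pathstart_def pathfinish_def)
  then show ?thesis
    using True assms(3) unfolding site_sub_crossing_1 two_crossings_eq
    by (cases "z = 0") (auto simp: site_lo_def site_len_def algebra_simps)
next
  case False
  have "Q 1 = half_turn e 1"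
    using assms(2) half_turn_ends(2) [of e] by (simp only: pathstart_def pathfinish_def)
  then show ?thesis
    using False assms(3) unfolding site_sub_crossing_1 two_crossings_eq
    by (cases "z = 0") (auto simp: site_lo_def site_len_def algebra_simps)
qed

lemma two_crossings_off_site:
  assumes "\<And>p y. y \<in> {0..1} \<Longrightarrow> z \<noteq> site_lo p + site_len p * y"
  shows "two_crossings P Q R e z = two_crossings P Q R e' z"
proof -
  have "\<not> (1/8 \<le> z \<and> z \<le> 1/4)"
    using assms [of "8 * z - 1" True] by (auto simp: site_lo_def site_len_def field_simps)
  moreover have "\<not> (1/2 \<le> z \<and> z \<le> 3/4)"
    using assms [of "4 * z - 2" False] by (auto simp: site_lo_def site_len_def field_simps)
  ultimately show ?thesis by (auto simp: two_crossings_eq)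
qed

lemma in_disc: "path_image P \<subseteq> disc \<Longrightarrow> z \<in> {0..1} \<Longrightarrow> P z \<in> disc"
  by (auto simp: path_image_def)

lemma two_crossings_near:
  assumes "path_image P \<subseteq> disc" "path_image Q \<subseteq> disc" "path_image R \<subseteq> disc" "\<bar>e\<bar> \<le> 1" "z \<in> {0..1}"
  shows "two_crossings P Q R e z \<in> disc \<or> 
    (\<exists>y p. y \<in> {0..1} \<and> z = site_lo p + site_len p * y \<and> two_crossings P Q R e z = half_turn e (if p then y else 1 - y))"
proof -
  consider "z \<le> 1/8" | "1/8 < z" "z \<le> 1/4" | "1/4 < z" "z \<le> 1/2" | "1/2 < z" "z \<le> 3/4" | "z > 3/4" by linarith
  then show ?thesis
  proof cases
    case 2
    then show ?thesis
      by (intro disjI2 exI [of _ "8 * z - 1"] exI [of _ True]) (simp add: two_crossings_eq site_lo_def site_len_def field_simps)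
  next
    case 4
    then show ?thesis
      by (intro disjI2 exI [of _ "4 * z - 2"] exI [of _ False]) (simp add: two_crossings_eq site_lo_def site_len_def field_simps)
  qed (use assms in_disc [of P "8 * z"] in_disc [of Q "4 * z - 1"] in_disc [of R "4 * z - 3"] in \<open>simp_all add: two_crossings_eq\<close>)
qed

text \<open>For e = 0 the half turns leave \<open>disc\<close>, but they hit base point 1 at their
  midpoints only, and being within 1/4 of it they stay away from base point 2. These midpoints
  become the double points.\<close>

lemma two_crossings_avoid:
  assumes "path_image P \<subseteq> disc" "path_image Q \<subseteq> disc" "path_image R \<subseteq> disc" "\<bar>e\<bar> \<le> 1" "z \<in> {0..1}"
  shows "norm (two_crossings P Q R e z) \<le> 1" "two_crossings P Q R e z \<noteq> base_point 2"
    "two_crossings P Q R e z = base_point 1 \<Longrightarrow> \<exists>p. z = site_lo p + site_len p * (1/2)"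
proof -
  have 1: "norm (two_crossings P Q R e z) < 1 \<and> two_crossings P Q R e z \<noteq> base_point 2 \<and>
      (two_crossings P Q R e z = base_point 1 \<longrightarrow> (\<exists>p. z = site_lo p + site_len p * (1/2)))"
    using two_crossings_near [OF assms]
  proof (elim disjE exE conjE)
    fix y p assume y: "y \<in> {0..1}" "z = site_lo p + site_len p * y"
      and eq: "two_crossings P Q R e z = half_turn e (if p then y else 1 - y)"
    define x where "x = (if p then y else 1 - y)"
    have x: "x \<in> {0..1}" using y by (auto simp: x_def)
    have "y = 1/2" if "x = 1/2" using that by (auto simp: x_def split: if_splits)
    then have "\<exists>p. z = site_lo p + site_len p * (1/2)" if "half_turn e x = base_point 1"
      using half_turn_eq_base_point_1(1) [OF x that] y(2) by metis
    then show ?thesis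
      unfolding eq x_def [symmetric]
      using near_base_point_1 [of "half_turn e x"] half_turn_near [OF assms(4) x] by simp
  qed (auto simp: disc_def simp del: base_point_simps)
  then show "norm (two_crossings P Q R e z) \<le> 1" "two_crossings P Q R e z \<noteq> base_point 2"
    "two_crossings P Q R e z = base_point 1 \<Longrightarrow> \<exists>p. z = site_lo p + site_len p * (1/2)" by auto
qed

section \<open>Clasps as words in half turns\<close>

definition stem :: "nat \<Rightarrow> real \<Rightarrow> complex" where
  "stem a = linepath (base_point 3) (base_point a - \<i> / 4)"

definition gen_circle :: "nat \<Rightarrow> real \<Rightarrow> complex" where
  "gen_circle a = part_circlepath (base_point a) (1/4) (- (pi / 2)) (3 * pi / 2)"

definition gen_path :: "nat \<Rightarrow> real \<Rightarrow> complex" where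
  "gen_path a = stem a +++ gen_circle a +++ reversepath (stem a)"

lemma pure_braid_gen_eq: "pure_braid_gen a 3 = third_strand (gen_path a)"
  by (simp add: pure_braid_gen_def third_strand_def gen_path_def stem_def gen_circle_def)

lemma third_strand_cases: "third_strand \<gamma> r = (if r = 3 then \<gamma> else (\<lambda>z. base_point r))"
  by (simp add: third_strand_def trivial_strands_def)

lemma braid_mult_third_strand: "braid_mult (third_strand a) (third_strand b) = third_strand (a +++ b)"
  by (simp add: braid_mult_def third_strand_cases fun_eq_iff joinpaths_def)

lemma braid_inverse_third_strand: "braid_inverse (third_strand a) = third_strand (reversepath a)"
  by (simp add: braid_inverse_def third_strand_cases fun_eq_iff reversepath_def)

definition sign_path :: "bool \<Rightarrow> (real \<Rightarrow> complex) \<Rightarrow> real \<Rightarrow> complex" where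
  "sign_path e p = (if e then p else reversepath p)"

lemma braid_sign_power_third_strand: "braid_sign_power (third_strand a) e = third_strand (sign_path e a)"
  by (simp add: braid_sign_power_def sign_path_def braid_inverse_third_strand)

definition commutator_path :: "(real \<Rightarrow> complex) \<Rightarrow> (real \<Rightarrow> complex) \<Rightarrow> real \<Rightarrow> complex" where
  "commutator_path u v = ((u +++ v) +++ reversepath u) +++ reversepath v"

lemma borromean_clasp_eq:
  "borromean_clasp (e\<^sub>1, e\<^sub>2, e) =
    third_strand (sign_path e (commutator_path (sign_path e\<^sub>1 (gen_path 1)) (sign_path e\<^sub>2 (gen_path 2))))"
  by (simp only: borromean_clasp.simps braid_commutator_def pure_braid_gen_eq braid_sign_power_third_strand
      braid_mult_third_strand braid_inverse_third_strand commutator_path_def)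

lemma trivial_strands_eq: "trivial_strands = third_strand (linepath (base_point 3) (base_point 3))"
  by (simp add: third_strand_cases trivial_strands_def fun_eq_iff linepath_refl)

lemma stem_path [simp]: "path (stem a)" "pathstart (stem a) = base_point 3" "pathfinish (stem a) = base_point a - \<i> / 4"
  by (simp_all add: stem_def)

lemma cis_three_half_pi: "cis (3 * pi / 2) = - \<i>"
  using sin_3over2_pi cos_3over2_pi by (simp add: complex_eq_iff)

lemma gen_circle_path [simp]:
  "path (gen_circle a)" "pathstart (gen_circle a) = base_point a - \<i> / 4" "pathfinish (gen_circle a) = base_point a - \<i> / 4"
  unfolding gen_circle_def pathstart_part_circlepath pathfinish_part_circlepath cis_conv_exp [symmetric]
  by (simp_all add: cis_three_half_pi complex_eq_iff)

lemma disc_iff: "w \<in> disc \<longleftrightarrow> norm w < 1 \<and> w \<noteq> - 1/2 \<and> w \<noteq> 0"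
  by (auto simp: disc_def)

lemma stem_disc:
  assumes "a \<in> {1, 2}"
  shows "path_image (stem a) \<subseteq> disc"
proof
  fix w assume w: "w \<in> path_image (stem a)"
  have "norm (base_point a - \<i> / 4) < 1"
    using assms norm_triangle_ineq4 [of "base_point a" "\<i> / 4"] by auto
  then have "closed_segment (base_point 3) (base_point a - \<i> / 4) \<subseteq> ball 0 1"
    by (intro closed_segment_subset convex_ball) auto
  then have "norm w < 1" using w by (auto simp: stem_def)
  moreover obtain u where "w = (1 - u) *\<^sub>R base_point 3 + u *\<^sub>R (base_point a - \<i> / 4)"
    using w by (auto simp: stem_def closed_segment_def)
  \<comment> \<open>The imaginary part of the point is \<open>- u / 4\<close>, so the segment meets
    the real axis only at base point 3.\<close>
  then have "w \<noteq> - 1/2 \<and> w \<noteq> 0" using assms by (auto simp: complex_eq_iff)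
  ultimately show "w \<in> disc" by (simp add: disc_iff)
qed

lemma gen_circle_sphere: "path_image (gen_circle a) \<subseteq> sphere (base_point a) (1/4)"
  unfolding gen_circle_def by (rule path_image_part_circlepath_subset') auto

lemma gen_circle_disc:
  assumes "a \<in> {1, 2}"
  shows "path_image (gen_circle a) \<subseteq> disc"
proof
  fix w assume "w \<in> path_image (gen_circle a)"
  then have w: "norm (w - base_point a) = 1/4"
    using gen_circle_sphere [of a] by (auto simp: dist_norm norm_minus_commute)
  then have "norm w \<le> 1/4 + norm (base_point a)"
    using norm_triangle_ineq [of "w - base_point a" "base_point a"] by simp
  then show "w \<in> disc" using assms w by (auto simp: disc_iff)
qed

lemma gen_path_path:
  assumes "a \<in> {1, 2}"
  shows "path (gen_path a)" "path_image (gen_path a) \<subseteq> disc" 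
    "pathstart (gen_path a) = base_point 3" "pathfinish (gen_path a) = base_point 3"
  using stem_disc [OF assms] gen_circle_disc [OF assms] by (simp_all add: gen_path_def path_image_join)

text \<open>Circle and rhombus, run through at these speeds, are always on the same side of the
  vertical line through base point 1: right in the first half, left in the second. At times 0, 1/2
  and 1 they are at the same point, below or above the centre. So the straight-line homotopy misses
  the centre.\<close>

lemma gen_circle_homotopic:
  "homotopic_paths disc (gen_circle 1) (half_turn 1 +++ reversepath (half_turn (- 1)))" (is "homotopic_paths _ ?c ?h")
proof (rule homotopic_paths_linear)
  fix x :: real assume x: "x \<in> {0..1}"
  have c: "Re (?c x) = - 1/2 + sin (2 * pi * x) / 4" "Im (?c x) = - cos (2 * pi * x) / 4"
  proof -
    have "linepath (- (pi / 2)) (3 * pi / 2) x = 2 * pi * x - pi / 2"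
      by (simp add: linepath_def algebra_simps diff_divide_distrib add_divide_distrib)
    then have "?c x = base_point 1 + 1/4 * cis (2 * pi * x - pi / 2)"
      by (simp add: gen_circle_def part_circlepath_def cis_conv_exp)
    then show "Re (?c x) = - 1/2 + sin (2 * pi * x) / 4" "Im (?c x) = - cos (2 * pi * x) / 4"
      by (simp_all add: cos_diff sin_diff)
  qed
  have h: "Re (?h x) = - 1/2 + (if x \<le> 1/2 then min (2 * x) (1 - 2 * x) else - min (2 - 2 * x) (2 * x - 1)) / 4"
      "Im (?h x) = (if x \<le> 1/2 then 4 * x - 1 else 3 - 4 * x) / 4"
    by (auto simp: joinpaths_def reversepath_def half_turn_def)
  have "?c x \<in> path_image ?c" using x by (auto simp: path_image_def)
  then have 1: "?c x \<in> cball (base_point 1) (1/4)" using gen_circle_sphere [of 1] by auto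
  have 2: "?h x \<in> cball (base_point 1) (1/4)"
    using half_turn_near [of 1 "2 * x"] half_turn_near [of "- 1" "2 - 2 * x"] x
    by (auto simp: joinpaths_def reversepath_def dist_norm norm_minus_commute simp del: base_point_simps)
  have avoid: "base_point 1 \<notin> closed_segment (?c x) (?h x)"
  proof
    assume "base_point 1 \<in> closed_segment (?c x) (?h x)"
    then obtain u where u: "0 \<le> u" "u \<le> 1" "base_point 1 = (1 - u) *\<^sub>R ?c x + u *\<^sub>R ?h x"
      by (auto simp: closed_segment_def)
    have re: "(1 - u) * (Re (?c x) + 1/2) + u * (Re (?h x) + 1/2) = 0"
      using arg_cong [OF u(3), of Re] by (simp add: algebra_simps diff_divide_distrib)
    have im: "(1 - u) * Im (?c x) + u * Im (?h x) = 0"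
      using arg_cong [OF u(3), of Im] by simp
    then have im': "(1 - u) * (- cos (2 * pi * x) / 4) + u * ((if x \<le> 1/2 then 4 * x - 1 else 3 - 4 * x) / 4) = 0"
      by (simp only: c h)
    consider "x = 0" | "0 < x" "x < 1/2" | "x = 1/2" | "1/2 < x" "x < 1" | "x = 1" using x by fastforce
    then show False
    proof cases
      case 1
      then show False using im' by (simp add: field_simps)
    next
      case 3
      then have "2 * pi * x = pi" by simp
      then have "cos (2 * pi * x) = - 1" by (simp only: cos_pi)
      then show False using im' 3 by (simp add: field_simps)
    next
      case 5
      then show False using im' by (simp add: field_simps)
    next
      case 2
      then have "sin (2 * pi * x) > 0" by (intro sin_gt_zero) auto
      then have "Re (?c x) + 1/2 > 0" "Re (?h x) + 1/2 > 0" using 2 by (auto simp: c h simp del: One_nat_def)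
      then show False using re u(1,2)
        by (smt (verit) mult_nonneg_nonneg mult_pos_pos)
    next
      case 4
      then have "sin (2 * pi * x) < 0" by (intro sin_lt_zero) auto
      then have "Re (?c x) + 1/2 < 0" "Re (?h x) + 1/2 < 0" using 4 by (auto simp: c h simp del: One_nat_def)
      then show False using re u(1,2)
        by (smt (verit) mult_nonneg_nonpos mult_pos_neg)
    qed
  qed
  show "closed_segment (?c x) (?h x) \<subseteq> disc"
  proof
    fix w assume w: "w \<in> closed_segment (?c x) (?h x)"
    have "closed_segment (?c x) (?h x) \<subseteq> cball (base_point 1) (1/4)"
      using 1 2 by (intro closed_segment_subset convex_cball)
    then have "norm (w - base_point 1) \<le> 1/4" using w by (auto simp: dist_norm norm_minus_commute)
    then show "w \<in> disc"
      using near_base_point_1 [of w] avoid w by (auto simp: disc_def simp del: base_point_simps)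
  qed
qed simp_all

lemma word_half_turn:
  assumes "\<bar>e\<bar> = 1"
  shows "word disc (base_point 1 - \<i> / 4) (half_turn e) [half_turn e] (base_point 1 + \<i> / 4)"
  using word_path [OF path_half_turn half_turn_disc [OF assms]] by simp

lemma word_stem: "word disc (base_point 3) (stem 1) [stem 1] (base_point 1 - \<i> / 4)"
  using word_path [OF stem_path(1) stem_disc [of 1]] by (simp del: base_point_simps)

lemma base_point_3_disc: "base_point 3 \<in> disc"
  by (simp add: disc_iff)

definition sgn_of :: "bool \<Rightarrow> real" where "sgn_of e = (if e then 1 else - 1)"

lemma abs_sgn_of [simp]: "\<bar>sgn_of e\<bar> = 1" "\<bar>- sgn_of e\<bar> = 1"
  by (simp_all add: sgn_of_def)

text \<open>Reversing the word interchanges the roles of the two half turns, so the exponent of the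
  generator enters only through the sign of the half turns.\<close>

lemma word_gen_path_1:
  "word disc (base_point 3) (sign_path e (gen_path 1))
    [stem 1, half_turn (sgn_of e), reversepath (half_turn (- sgn_of e)), reversepath (stem 1)] (base_point 3)"
proof -
  have "word disc (base_point 1 - \<i> / 4) (gen_circle 1) [half_turn 1, reversepath (half_turn (- 1))] (base_point 1 - \<i> / 4)"
    using word_homotopic [OF word_join [OF word_half_turn [of 1] word_reverse [OF word_half_turn [of "- 1"]]] gen_circle_homotopic]
    by simp
  from word_join [OF word_stem word_join [OF this word_reverse [OF word_stem]]]
  have *: "word disc (base_point 3) (gen_path 1) [stem 1, half_turn 1, reversepath (half_turn (- 1)), reversepath (stem 1)] (base_point 3)"
    by (simp add: gen_path_def)
  from word_reverse [OF this] * show ?thesis by (cases e) (simp_all add: sign_path_def sgn_of_def)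
qed

lemma word_gen_path_2:
  "word disc (base_point 3) (sign_path e (gen_path 2)) [sign_path e (gen_path 2)] (base_point 3)"
  using word_path [of "sign_path e (gen_path 2)" disc] gen_path_path [of 2]
  by (cases e) (simp_all add: sign_path_def del: base_point_simps)

text \<open>
  For \<open>\<epsilon> = \<plusminus>1\<close> the exponent of \<open>x\<^sub>1\<^sub>3\<close>, the path \<open>Q\<close> starts by going back along \<open>half_turn (- \<epsilon>)\<close>: the half
  turns with \<open>e = \<epsilon>\<close> are then completed to full turns, and those with \<open>e = - \<epsilon>\<close> are undone.
\<close>

definition clasp_paths ::
    "bool \<times> bool \<times> bool \<Rightarrow> (real \<Rightarrow> complex) \<Rightarrow> (real \<Rightarrow> complex) \<Rightarrow> (real \<Rightarrow> complex) \<Rightarrow> (real \<Rightarrow> complex) \<Rightarrow> bool" where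
  "clasp_paths \<sigma> \<kappa> P Q R \<longleftrightarrow> borromean_clasp \<sigma> = third_strand \<kappa> \<and>
    path P \<and> path_image P \<subseteq> disc \<and> pathstart P = base_point 3 \<and> pathfinish P = base_point 1 - \<i> / 4 \<and>
    path Q \<and> path_image Q \<subseteq> disc \<and> pathstart Q = base_point 1 + \<i> / 4 \<and> pathfinish Q = base_point 1 + \<i> / 4 \<and>
    path R \<and> path_image R \<subseteq> disc \<and> pathstart R = base_point 1 - \<i> / 4 \<and> pathfinish R = base_point 3 \<and>
    homotopic_paths disc (two_crossings P Q R (sgn_of (fst \<sigma>))) \<kappa> \<and>
    homotopic_paths disc (two_crossings P Q R (- sgn_of (fst \<sigma>))) (linepath (base_point 3) (base_point 3))"

lemma ex_clasp_paths: "\<exists>\<kappa> P Q R. clasp_paths \<sigma> \<kappa> P Q R"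
proof -
  obtain e\<^sub>1 e\<^sub>2 e where \<sigma>: "\<sigma> = (e\<^sub>1, e\<^sub>2, e)" by (cases \<sigma>)
  define v where "v = sign_path e\<^sub>2 (gen_path 2)"
  define \<epsilon> where "\<epsilon> = sgn_of e\<^sub>1"
  define c where "c = linepath (base_point 3) (base_point 3)"
  \<comment> \<open>With u the power of the first generator, the clasp is the product of \<alpha>,
    u, \<beta>, the inverse of u, and \<gamma>: the factors v are distributed as (1, v, inverse of
    v) for the commutator and as (v, inverse of v, 1) for its inverse. Either way \<alpha>, \<beta>,
    \<gamma> cancel once u is trivial.\<close>
  define \<alpha> \<beta> \<gamma> where "\<alpha> = (if e then c else v)" "\<beta> = sign_path e v" "\<gamma> = (if e then reversepath v else c)"
  define as bs cs where "as = (if e then [] else [v])" "bs = [sign_path e v]" "cs = (if e then [reversepath v] else [])"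
  define l where "l = stem 1"
  define P where "P = \<alpha> +++ l"
  define Q where "Q = (reversepath (half_turn (- \<epsilon>)) +++ reversepath l) +++ \<beta> +++ (l +++ half_turn (- \<epsilon>))"
  define R where "R = reversepath l +++ \<gamma>"
  have v: "word disc (base_point 3) v [v] (base_point 3)"
    unfolding v_def by (rule word_gen_path_2)
  have v': "word disc (base_point 3) (reversepath v) [reversepath v] (base_point 3)"
    using word_reverse [OF v] by simp
  have c: "word disc (base_point 3) c [] (base_point 3)"
    unfolding c_def by (rule word_const [OF base_point_3_disc])
  have \<alpha>: "word disc (base_point 3) \<alpha> as (base_point 3)" and \<beta>: "word disc (base_point 3) \<beta> bs (base_point 3)"
    and \<gamma>: "word disc (base_point 3) \<gamma> cs (base_point 3)"
    using v v' c by (auto simp: \<alpha>_\<beta>_\<gamma>_def as_bs_cs_def sign_path_def)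
  have l: "word disc (base_point 3) l [l] (base_point 1 - \<i> / 4)"
    unfolding l_def by (rule word_stem)
  have h: "word disc (base_point 1 - \<i> / 4) (half_turn x) [half_turn x] (base_point 1 + \<i> / 4)" if "x \<in> {\<epsilon>, - \<epsilon>}" for x
    using that by (intro word_half_turn) (auto simp: \<epsilon>_def)
  note h' = word_reverse [OF h]
  note wP = word_join [OF \<alpha> l, folded P_def]
    and wQ = word_join [OF word_join [OF h' word_reverse [OF l]] word_join [OF \<beta> word_join [OF l h]], of "- \<epsilon>" "- \<epsilon>", folded Q_def]
    and wR = word_join [OF word_reverse [OF l] \<gamma>, folded R_def]
  \<comment> \<open>The half turns marked x are the two that are varied; those with
    \<open>- \<epsilon>\<close> belong to Q and stay.\<close>
  have W: "word disc (base_point 3) (two_crossings P Q R x)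
      (as @ l # half_turn x # reversepath (half_turn (- \<epsilon>)) # reversepath l # bs @ l # half_turn (- \<epsilon>) # reversepath (half_turn x) # reversepath l # cs)
      (base_point 3)" if "x \<in> {\<epsilon>, - \<epsilon>}" for x
    using word_join [OF word_join [OF word_join [OF wP h [OF that]] wQ] word_join [OF h' [OF that] wR]]
    by (simp add: two_crossings_def)
  define \<kappa> where "\<kappa> = sign_path e (commutator_path (sign_path e\<^sub>1 (gen_path 1)) v)"
  have u: "word disc (base_point 3) (sign_path e\<^sub>1 (gen_path 1)) [l, half_turn \<epsilon>, reversepath (half_turn (- \<epsilon>)), reversepath l] (base_point 3)"
    unfolding \<epsilon>_def l_def by (rule word_gen_path_1)
  have comm: "word disc (base_point 3) (commutator_path (sign_path e\<^sub>1 (gen_path 1)) v)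
      [l, half_turn \<epsilon>, reversepath (half_turn (- \<epsilon>)), reversepath l, v,
       l, half_turn (- \<epsilon>), reversepath (half_turn \<epsilon>), reversepath l, reversepath v] (base_point 3)"
    using word_join [OF word_join [OF word_join [OF u v] word_reverse [OF u]] v'] by (simp add: commutator_path_def)
  have "word disc (base_point 3) \<kappa>
      (as @ l # half_turn \<epsilon> # reversepath (half_turn (- \<epsilon>)) # reversepath l # bs @ l # half_turn (- \<epsilon>) # reversepath (half_turn \<epsilon>) # reversepath l # cs)
      (base_point 3)"
    using comm word_reverse [OF comm] by (simp add: \<kappa>_def sign_path_def as_bs_cs_def)
  from word_unique [OF W this] have clasped: "homotopic_paths disc (two_crossings P Q R \<epsilon>) \<kappa>" by simp
  \<comment> \<open>With x = - \<epsilon> each varied half turn meets its own reverse. Cancelling it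
    brings a stem next to its reverse, and after both powers of the first generator have gone, only
    v and its reverse remain.\<close>
  have "word disc (base_point 3) (two_crossings P Q R (- \<epsilon>)) 
     ((as @ [l]) @ half_turn (- \<epsilon>) # reversepath (half_turn (- \<epsilon>)) # (reversepath l # bs @ l # half_turn (- \<epsilon>) # reversepath (half_turn (- \<epsilon>)) # reversepath l # cs)) (base_point 3)"
    using W [of "- \<epsilon>"] by simp
  from word_cancel [OF this]
  have "word disc (base_point 3) (two_crossings P Q R (- \<epsilon>)) 
     (as @ l # reversepath l # (bs @ l # half_turn (- \<epsilon>) # reversepath (half_turn (- \<epsilon>)) # reversepath l # cs)) (base_point 3)" by simp
  from word_cancel [OF this]
  have "word disc (base_point 3) (two_crossings P Q R (- \<epsilon>)) 
     ((as @ bs @ [l]) @ half_turn (- \<epsilon>) # reversepath (half_turn (- \<epsilon>)) # (reversepath l # cs)) (base_point 3)" by simp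
  from word_cancel [OF this]
  have "word disc (base_point 3) (two_crossings P Q R (- \<epsilon>)) ((as @ bs) @ l # reversepath l # cs) (base_point 3)" by simp
  from word_cancel [OF this]
  have "word disc (base_point 3) (two_crossings P Q R (- \<epsilon>)) ([] @ v # reversepath v # []) (base_point 3)"
    by (simp add: as_bs_cs_def sign_path_def split: if_splits)
  from word_unique [OF word_cancel [OF this], of c] c
  have "homotopic_paths disc (two_crossings P Q R (- \<epsilon>)) c" by simp
  with clasped have "clasp_paths \<sigma> \<kappa> P Q R"
    using word_ends [OF wP] word_ends [OF wQ] word_ends [OF wR]
    by (simp add: clasp_paths_def \<sigma> borromean_clasp_eq \<kappa>_def v_def \<epsilon>_def c_def del: borromean_clasp.simps base_point_simps)
  then show ?thesis by blast
qed

text \<open>Drags the straight third strand onto an arbitrary loop, possibly through the other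
  strands. The map is merely continuous, which is what the singular filling requires.\<close>

lemma third_strand_move:
  assumes chart: "is_chart \<phi>" and \<gamma>: "path \<gamma>" "pathstart \<gamma> = base_point 3" "pathfinish \<gamma> = base_point 3"
  obtains \<Gamma> g where "acts_in_chart \<phi> g \<Gamma>" "continuous_on S3 \<Gamma>"
    "\<And>r z. r \<in> {1..3} \<Longrightarrow> z \<in> {0..1} \<Longrightarrow> g (trivial_strands r z, z) = (third_strand \<gamma> r z, z)"
proof -
  define c where "c z = \<gamma> (clamp01 z)" for z
  \<comment> \<open>The bump about base point 3 has radius 1/4, while the other base points and the
    boundary of the disc are at distance at least 1/2.\<close>
  define g where "g x = (fst x + max 0 (1 - 4 * norm (fst x - base_point 3)) *\<^sub>R (c (snd x) - base_point 3), snd x)" for x :: space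
  have "continuous_on UNIV c" unfolding c_def by (rule continuous_clamp01 [OF \<gamma>(1)])
  then have "continuous_on UNIV (\<lambda>x :: space. c (snd x))"
    by (rule continuous_on_compose2 [OF _ continuous_on_snd [OF continuous_on_id]]) auto
  then have cont: "continuous_on UNIV g"
    unfolding g_def by (intro continuous_intros)
  have supp: "g x = x" if "x \<notin> cylinder" for x
  proof -
    obtain w z where x: "x = (w, z)" by (cases x)
    from that [unfolded x] show ?thesis
    proof (cases rule: not_in_cylinder_cases)
      case 1
      then have "norm (w - base_point 3) \<ge> 1/2" using norm_triangle_ineq2 [of w "base_point 3"] by simp
      then show ?thesis by (simp add: g_def x max_def)
    qed (use \<gamma> in \<open>auto simp: g_def x c_def clamp01 pathstart_def pathfinish_def\<close>)
  qed
  obtain \<Gamma> where "acts_in_chart \<phi> g \<Gamma>" "continuous_on S3 \<Gamma>"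
    by (rule acts_in_chart_continuous [OF chart cont supp])
  moreover have "g (trivial_strands r z, z) = (third_strand \<gamma> r z, z)" if "r \<in> {1..3}" "z \<in> {0..1}" for r z
  proof -
    have "r = 1 \<or> r = 2 \<or> r = 3" using that(1) by auto
    then show ?thesis
      using that(2) by (auto simp: g_def trivial_strands_def c_def clamp01 max_def)
  qed
  ultimately show thesis by (rule that)
qed

section \<open>Filling all balls at once\<close>

context triple_sites
begin

lemma fill_periodic: "i < \<mu> \<Longrightarrow> fill 3 {..<d} S F i (t + 1) = fill 3 {..<d} S F i t"
proof -
  assume i: "i < \<mu>"
  have "t + 1 - p \<in> \<int> \<longleftrightarrow> t - p \<in> \<int>" for p :: real
    using Ints_add [of "t - p" 1] Ints_diff [of "t + 1 - p" 1] by (auto simp: algebra_simps)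
  then have "at_site S k r z i (t + 1) \<longleftrightarrow> at_site S k r z i t" for k r z
    by (simp add: at_site_def)
  moreover have "curve S i (t + 1) = curve S i t" using closed i by (simp add: closed_curves_def)
  ultimately show ?thesis by (simp add: fill_def)
qed

lemma fill_S3:
  assumes "i < \<mu>" "strands_in_disc F"
  shows "fill 3 {..<d} S F i t \<in> S3"
proof (cases rule: fill_cases [of i t])
  case (1 k r z)
  then show ?thesis
    using assms(2) chart_S3 [OF chart [OF 1(1)], of "(F k r z, z)"] by (auto simp: strands_in_disc_def cylinder_def)
next
  case 2
  then show ?thesis using curve_S3 assms(1) by simp
qed

text \<open>Continuity where a strand enters or leaves a ball is avoided as a separate question: the
  filling is the given link followed by continuous self-maps of the sphere, one for each
  ball.\<close>

lemma continuous_fill: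
  assumes \<gamma>: "\<And>k. k < d \<Longrightarrow> path (\<gamma> k) \<and> pathstart (\<gamma> k) = base_point 3 \<and> pathfinish (\<gamma> k) = base_point 3"
    and norm: "\<And>k z. k < d \<Longrightarrow> z \<in> {0..1} \<Longrightarrow> norm (\<gamma> k z) \<le> 1" and i: "i < \<mu>"
  shows "continuous_on UNIV (fill 3 {..<d} S (\<lambda>k. third_strand (\<gamma> k)) i)"
proof -
  define F where "F n = (\<lambda>k. if k < n then third_strand (\<gamma> k) else trivial_strands)" for n
  have F: "strands_in_disc (F n)" for n
    using norm norm_base_point_le_1
    by (auto simp: strands_in_disc_def F_def trivial_strands_def intro!: norm_third_strand_le_1)
  have "continuous_on UNIV (fill 3 {..<d} S (F n) i)" if "n \<le> d" for n
    using that
  proof (induction n)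
    case 0
    have "fill 3 {..<d} S (F 0) i = curve S i" by (rule ext) (simp add: F_def fill_trivial)
    then show ?case using closed i by (simp add: closed_curves_def)
  next
    case (Suc n)
    obtain \<Gamma> g where G: "acts_in_chart (chart S n) g \<Gamma>" "continuous_on S3 \<Gamma>"
      and g: "\<And>r z. r \<in> {1..3} \<Longrightarrow> z \<in> {0..1} \<Longrightarrow> g (trivial_strands r z, z) = (third_strand (\<gamma> n) r z, z)"
      using third_strand_move [OF chart, of n "\<gamma> n"] \<gamma> [of n] Suc.prems by (metis Suc_le_lessD)
    have "(F n)(n := third_strand (\<gamma> n)) = F (Suc n)" by (auto simp: F_def)
    moreover have "\<Gamma> (fill 3 {..<d} S (F n) i t) = fill 3 {..<d} S ((F n)(n := third_strand (\<gamma> n))) i t" for t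
      by (rule fill_update [OF _ i G(1) _ F]) (use Suc.prems norm g in \<open>auto simp: F_def intro!: norm_third_strand_le_1\<close>)
    ultimately have "fill 3 {..<d} S (F (Suc n)) i = (\<lambda>t. \<Gamma> (fill 3 {..<d} S (F n) i t))" by auto
    moreover have "continuous_on UNIV (\<lambda>t. \<Gamma> (fill 3 {..<d} S (F n) i t))"
      using Suc by (intro continuous_on_compose2 [OF G(2)]) (auto intro: fill_S3 [OF i F])
    ultimately show ?case by simp
  qed
  from this [of d] have "continuous_on UNIV (fill 3 {..<d} S (F d) i)" by simp
  moreover have "fill 3 {..<d} S (F d) i = fill 3 {..<d} S (\<lambda>k. third_strand (\<gamma> k)) i"
    by (rule ext, rule fill_cong) (simp add: F_def)
  ultimately show ?thesis by simp
qed

lemma fill_homotopic_all: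
  assumes hom: "\<And>k. homotopic_paths disc (a k) (b k)"
  shows "ambient_isotopic \<mu> (fill 3 {..<d} S (\<lambda>k. third_strand (a k))) (fill 3 {..<d} S (\<lambda>k. third_strand (b k)))"
proof -
  define F where "F n = (\<lambda>k. third_strand (if k < n then b k else a k))" for n
  have F: "strands_in_disc (F n)" for n
    using path_image_disc_norm [OF homotopic_paths_imp_subset [OF hom, THEN conjunct1]]
      path_image_disc_norm [OF homotopic_paths_imp_subset [OF hom, THEN conjunct2]]
    by (auto simp: strands_in_disc_def F_def intro!: norm_third_strand_le_1)
  have "ambient_isotopic \<mu> (fill 3 {..<d} S (F 0)) (fill 3 {..<d} S (F n))" if "n \<le> d" for n
    using that
  proof (induction n)
    case (Suc n)
    have "(F n)(n := third_strand (a n)) = F n" "(F n)(n := third_strand (b n)) = F (Suc n)"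
      by (auto simp: F_def fun_eq_iff)
    then have "ambient_isotopic \<mu> (fill 3 {..<d} S (F n)) (fill 3 {..<d} S (F (Suc n)))"
      using fill_homotopic [OF Suc_le_lessD [OF Suc.prems] hom [of n] F [of n]] by (simp only:)
    then show ?case by (rule ambient_isotopic_trans [OF Suc.IH [OF Suc_leD [OF Suc.prems]]])
  qed (simp add: ambient_isotopic_refl)
  from this [of d] have "ambient_isotopic \<mu> (fill 3 {..<d} S (F 0)) (fill 3 {..<d} S (F d))" by simp
  moreover have "F 0 = (\<lambda>k. third_strand (a k))" by (simp add: F_def)
  moreover have "fill 3 {..<d} S (F d) i t = fill 3 {..<d} S (\<lambda>k. third_strand (b k)) i t" for i t
    by (rule fill_cong) (simp add: F_def)
  ultimately show ?thesis by (simp add: ambient_isotopic_def)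
qed

end

section \<open>The double crossing singular link\<close>

locale clasp_sites = triple_sites +
  fixes \<sigma> :: "nat \<Rightarrow> bool \<times> bool \<times> bool" and \<kappa> P Q R :: "nat \<Rightarrow> real \<Rightarrow> complex"
  assumes paths: "clasp_paths (\<sigma> k) (\<kappa> k) (P k) (Q k) (R k)"
begin

abbreviation e\<^sub>1 :: "nat \<Rightarrow> bool" where
  "e\<^sub>1 k \<equiv> fst (\<sigma> k)"

lemma P: "path (P k)" "path_image (P k) \<subseteq> disc" "pathstart (P k) = base_point 3" "pathfinish (P k) = base_point 1 - \<i> / 4"
  and Q: "path (Q k)" "path_image (Q k) \<subseteq> disc" "pathstart (Q k) = base_point 1 + \<i> / 4" "pathfinish (Q k) = base_point 1 + \<i> / 4"
  and R: "path (R k)" "path_image (R k) \<subseteq> disc" "pathstart (R k) = base_point 1 - \<i> / 4" "pathfinish (R k) = base_point 3"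
  using paths [of k] by (simp_all only: clasp_paths_def)

definition strand :: "nat \<Rightarrow> real \<Rightarrow> real \<Rightarrow> complex" where
  "strand k e = two_crossings (P k) (Q k) (R k) e"

lemma strand_path:
  "k < d \<Longrightarrow> path (strand k e) \<and> pathstart (strand k e) = base_point 3 \<and> pathfinish (strand k e) = base_point 3"
  using P Q R by (simp add: strand_def two_crossings_def del: base_point_simps)

lemma strand_avoid:
  assumes "k < d" "\<bar>e\<bar> \<le> 1" "z \<in> {0..1}"
  shows "norm (strand k e z) \<le> 1" "strand k e z \<noteq> base_point 2"
    "strand k e z = base_point 1 \<Longrightarrow> \<exists>p. z = site_lo p + site_len p * (1/2)"
  using two_crossings_avoid [OF P(2) Q(2) R(2) assms(2,3)] assms(1) unfolding strand_def by blast+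

definition filled :: "(nat \<Rightarrow> real) \<Rightarrow> point curves" where
  "filled e = fill 3 {..<d} S (\<lambda>k. third_strand (strand k (e k)))"

text \<open>
  The pair is labelled so that resolving the first double point positively always gives the clasp: the
  site \<open>(k, True)\<close> is the first half turn if \<open>x\<^sub>1\<^sub>3\<close> has exponent \<open>1\<close> and the second one otherwise.
\<close>

definition double :: "(nat \<times> bool) sited_curves" where
  "double =
    \<lparr>curve = filled (\<lambda>k. 0),
     chart = (\<lambda>(k, b) x. chart S k (site_sub (b = e\<^sub>1 k) x)),
     comp = (\<lambda>(k, b) r. comp S k (if r = 1 then 3 else 1)),
     par = (\<lambda>(k, b) r z. par S k (if r = 1 then 3 else 1) (site_lo (b = e\<^sub>1 k) + site_len (b = e\<^sub>1 k) * z))\<rparr>"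

lemma double_sel [simp]:
  "curve double = filled (\<lambda>k. 0)"
  "chart double (k, b) x = chart S k (site_sub (b = e\<^sub>1 k) x)"
  "comp double (k, b) r = comp S k (if r = 1 then 3 else 1)"
  "par double (k, b) r z = par S k (if r = 1 then 3 else 1) (site_lo (b = e\<^sub>1 k) + site_len (b = e\<^sub>1 k) * z)"
  by (simp_all add: double_def)

lemma at_site_double:
  "at_site double (k, b) r z i t \<longleftrightarrow>
    z \<in> {0..1} \<and> at_site S k (if r = 1 then 3 else 1) (site_lo (b = e\<^sub>1 k) + site_len (b = e\<^sub>1 k) * z) i t"
  using site_in_01 by (auto simp: at_site_def)

lemma is_chart_double: "k < d \<Longrightarrow> is_chart (chart double (k, b))"
proof -
  assume "k < d"
  then have "is_chart (\<lambda>x. chart S k (site_sub (b = e\<^sub>1 k) x))"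
    unfolding site_sub_def by (intro is_chart_subcylinder chart) (auto simp: site_lo_def site_len_def)
  then show ?thesis by (simp add: double_def)
qed

lemma strands_in_disc: "(\<And>k. k < d \<Longrightarrow> \<bar>e k\<bar> \<le> 1) \<Longrightarrow> strands_in_disc (\<lambda>k. third_strand (strand k (e k)))"
  using strand_avoid(1) by (auto simp: strands_in_disc_def intro!: norm_third_strand_le_1)

lemma filled_site:
  assumes "k < d" "r \<in> {1..3}" "at_site S k r z i t"
  shows "filled e i t = chart S k (third_strand (strand k (e k)) r z, z)"
  using fill_site [OF assms] by (simp add: filled_def)

lemma strand_cylinder:
  assumes "k < d" "r \<in> {1..3}" "\<bar>e\<bar> \<le> 1" "z \<in> {0..1}"
  shows "(third_strand (strand k e) r z, z) \<in> cylinder"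
  using norm_third_strand_le_1 [of r "strand k e" z] strand_avoid(1) [OF assms(1,3,4)] assms by (simp add: cylinder_def)

lemma filled_in_ball:
  assumes k: "k < d" and i: "i < \<mu>" and x: "x \<in> cylinder" and eq: "filled (\<lambda>k. 0) i t = chart S k x"
  obtains r z where "r \<in> {1..3}" "at_site S k r z i t" "z \<in> {0..1}" "x = (third_strand (strand k 0) r z, z)"
proof (cases rule: fill_cases [of i t])
  case (1 j r z)
  have c: "(third_strand (strand j 0) r z, z) \<in> cylinder" by (rule strand_cylinder) (use 1 in auto)
  have e: "chart S j (third_strand (strand j 0) r z, z) = chart S k x"
    using eq 1(5) by (simp add: filled_def)
  from disjoint [OF 1(1) k e c x] have "j = k" .
  moreover from this have "x = (third_strand (strand k 0) r z, z)"
    using inj_onD [OF inj_on_chart [OF chart [OF k]] _ x c] e by simp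
  ultimately show thesis using 1 that by simp
next
  case 2
  then show thesis using k i x eq by (simp add: filled_def image_iff)
qed

lemma sites_double: "sites \<mu> 2 (crossing 0) (double_sites d) double"
  unfolding sites_def
proof (intro conjI ballI allI impI)
  fix s :: "nat \<times> bool" assume "s \<in> double_sites d"
  then obtain k b where s: "s = (k, b)" "k < d" by (auto simp: double_sites_def)
  let ?p = "b = e\<^sub>1 k"
  show "is_chart (chart double s)" unfolding s by (rule is_chart_double [OF s(2)])
  show "chart double s ` cylinder \<inter> chart double s' ` cylinder = {}" if "s' \<in> double_sites d" "s \<noteq> s'" for s'
  proof -
    obtain k' b' where s': "s' = (k', b')" "k' < d" using \<open>s' \<in> double_sites d\<close> by (auto simp: double_sites_def)
    have False if x: "x \<in> cylinder" "x' \<in> cylinder" "chart double s x = chart double s' x'" for x x'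
    proof -
      note 1 = site_sub_cylinder [OF x(1), of ?p] and 2 = site_sub_cylinder [OF x(2), of "b' = e\<^sub>1 k'"]
      have eq: "chart S k (site_sub ?p x) = chart S k' (site_sub (b' = e\<^sub>1 k') x')"
        using x(3) by (simp add: s s')
      have k: "k = k'" by (rule disjoint [OF s(2) s'(2) eq 1(1) 2(1)])
      have "site_sub ?p x = site_sub (b' = e\<^sub>1 k') x'"
        using inj_onD [OF inj_on_chart [OF chart [OF s(2)]] _ 1(1) 2(1)] eq k by simp
      moreover obtain y y' where "y \<in> {0..1}" "y' \<in> {0..1}"
          "snd (site_sub ?p x) = site_lo ?p + site_len ?p * y"
          "snd (site_sub (b' = e\<^sub>1 k') x') = site_lo (b' = e\<^sub>1 k') + site_len (b' = e\<^sub>1 k') * y'"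
        using 1(3) 2(3) by blast
      \<comment> \<open>The two sites of one ball lie over disjoint intervals of heights.\<close>
      ultimately have "?p = (b' = e\<^sub>1 k')" using site_pos_unique [of ?p y "b' = e\<^sub>1 k'" y'] by simp
      then show False using \<open>s \<noteq> s'\<close> k by (auto simp: s s')
    qed
    then show ?thesis
      by (intro equals0I, elim IntE imageE) (simp del: split_paired_All)
  qed
  show "comp double s r < \<mu>" for r
    using comp_less [OF s(2)] by (simp add: s)
  show "continuous_on {0..1} (par double s r)" for r
  proof -
    have "continuous_on {0..1} (\<lambda>z. par S k (if r = 1 then 3 else 1) (site_lo ?p + site_len ?p * z))"
    proof (rule continuous_on_compose2 [OF par_continuous [OF s(2)]])
      show "continuous_on {0..1} (\<lambda>z. site_lo ?p + site_len ?p * z)" by (intro continuous_intros)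
    qed (use site_in_01 [of _ ?p] in auto)
    then show ?thesis by (simp add: s double_def)
  qed
  show "strict_mono_on {0..1} (par double s r)" for r
  proof (rule strict_mono_onI)
    fix y z :: real assume "y \<in> {0..1}" "z \<in> {0..1}" "y < z"
    then show "par double s r y < par double s r z"
      using strict_mono_onD [OF par_mono [OF s(2), of "if r = 1 then 3 else 1"], OF _ site_in_01 site_in_01, of y z ?p ?p] site_len_pos [of ?p]
      by (simp add: s)
  qed
  show "curve double (comp double s r) (par double s r z) = chart double s (crossing 0 r z, z)"
    if r: "r \<in> {1..2}" and z: "z \<in> {0..1}" for r z
  proof -
    \<comment> \<open>Strand 1 of the crossing is the third strand of the ball, strand 2 is the
      first.\<close>
    define r' :: nat where "r' = (if r = 1 then 3 else 1)"
    define y where "y = site_lo ?p + site_len ?p * z"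
    have "at_site S k r' y (comp S k r') (par S k r' y)"
      using site_in_01 [OF z] by (simp add: at_site_def y_def)
    then have "filled (\<lambda>k. 0) (comp S k r') (par S k r' y) = chart S k (third_strand (strand k 0) r' y, y)"
      using filled_site [OF s(2), of r' y _ _ "\<lambda>_. 0"] by (simp add: r'_def)
    also have "(third_strand (strand k 0) r' y, y) = site_sub ?p (crossing 0 r z, z)"
    proof (cases "r = 1")
      case True
      then show ?thesis
        using two_crossings_site [OF P(4) [of k] Q(4) [of k] z, of ?p 0 "R k"]
        by (simp add: r'_def strand_def y_def cong: if_cong)
    next
      case False
      then have "r = 2" using r by auto
      then show ?thesis using site_sub_crossing_2 [of ?p 0 z] by (simp add: r'_def y_def)
    qed
    finally show ?thesis by (simp add: s r'_def y_def)
  qed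
  show "\<exists>r\<in>{1..2}. \<exists>z. at_site double s r z i t" if i: "i < \<mu>" and t: "curve double i t \<in> chart double s ` cylinder" for i t
  proof -
    obtain x where x: "x \<in> cylinder" "filled (\<lambda>k. 0) i t = chart S k (site_sub ?p x)"
      using t by (auto simp: s simp del: split_paired_All split_paired_Ex)
    note sub = site_sub_cylinder [OF x(1), of ?p]
    obtain r z where rz: "r \<in> {1..3}" "at_site S k r z i t" "z \<in> {0..1}" "site_sub ?p x = (third_strand (strand k 0) r z, z)"
      by (rule filled_in_ball [OF s(2) i sub(1) x(2)])
    obtain y where y: "y \<in> {0..1}" "z = site_lo ?p + site_len ?p * y"
      using sub(3) rz(4) by auto
    \<comment> \<open>The site is within 3/8 of base point 1, the second strand at distance
      1/2.\<close>
    have "r \<noteq> 2" using sub(2) rz(4) by auto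
    then consider "r = 3" | "r = 1" using rz(1) by fastforce
    then show ?thesis
    proof cases
      case 1
      then show ?thesis using rz y by (intro bexI [of _ 1] exI [of _ y]) (auto simp: s at_site_double)
    next
      case 2
      then show ?thesis using rz y by (intro bexI [of _ 2] exI [of _ y]) (auto simp: s at_site_double)
    qed
  qed
qed

lemma double_points:
  assumes ij: "i < \<mu>" "j < \<mu>" and eq: "filled (\<lambda>k. 0) i t = filled (\<lambda>k. 0) j u"
  shows "(i = j \<and> t - u \<in> \<int>) \<or> (\<exists>s\<in>double_sites d. filled (\<lambda>k. 0) i t = chart double s (0, 1/2))"
proof (cases rule: fill_cases [of i t])
  case (1 k r z)
  define x where "x = (third_strand (strand k 0) r z, z)"
  have c: "x \<in> cylinder" unfolding x_def by (rule strand_cylinder) (use 1 in auto)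
  have fx: "filled (\<lambda>k. 0) i t = chart S k x" using 1(5) by (simp add: filled_def x_def)
  obtain r' z' where 2: "r' \<in> {1..3}" "at_site S k r' z' j u" "z' \<in> {0..1}" "x = (third_strand (strand k 0) r' z', z')"
    by (rule filled_in_ball [OF 1(1) ij(2) c]) (use fx eq in auto)
  then have z: "z' = z" and tr: "third_strand (strand k 0) r z = third_strand (strand k 0) r' z" by (auto simp: x_def)
  show ?thesis
  proof (cases "r = r'")
    case True
    have "t - par S k r z \<in> \<int>" "u - par S k r z \<in> \<int>" "i = j"
      using 1(3) 2(2) True z by (auto simp: at_site_def)
    from Ints_diff [OF this(1,2)] \<open>i = j\<close> show ?thesis by simp
  next
    case False
    have r: "r = 1 \<or> r = 2 \<or> r = 3" "r' = 1 \<or> r' = 2 \<or> r' = 3" using 1(2) 2(1) by auto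
    note av = strand_avoid [OF 1(1) _ 1(4), of 0]
    \<comment> \<open>Two distinct strands meet at one height, so one of them is the third; as it
      avoids the second, the other is the first.\<close>
    have on: "strand k 0 z = base_point 1" "third_strand (strand k 0) r z = base_point 1"
      using r False tr av(2) by auto
    then obtain p where p: "z = site_lo p + site_len p * (1/2)" using av(3) by auto
    define b where "b = (p = e\<^sub>1 k)"
    have b: "(b = e\<^sub>1 k) = p" by (auto simp: b_def)
    have "site_sub p (0, 1/2) = x"
      using on(2) by (simp add: x_def p site_sub_def subcylinder_def)
    then have "filled (\<lambda>k. 0) i t = chart double (k, b) (0, 1/2)" by (simp add: fx b)
    then show ?thesis using 1(1) by (auto simp: double_sites_def)
  qed
next
  case 2
  have i: "filled (\<lambda>k. 0) i t = curve S i t" using 2 by (simp add: filled_def)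
  show ?thesis
  proof (cases rule: fill_cases [of j u])
    case (1 k r z)
    have "(third_strand (strand k 0) r z, z) \<in> cylinder" by (rule strand_cylinder) (use 1 in auto)
    moreover have "curve S i t = chart S k (third_strand (strand k 0) r z, z)"
      using i eq 1(5) by (simp add: filled_def)
    ultimately show ?thesis using 2(2) [OF 1(1) ij(1)] by (metis imageI)
  next
    case 2
    then have "curve S i t = curve S j u" using i eq by (simp add: filled_def)
    then show ?thesis using embedded ij unfolding embedded_def by blast
  qed
qed

text \<open>Both double points of a pair involve the third and the first strand of the same ball, so
  their sets of components coincide.\<close>

lemma double_singular: "double_singular_link \<mu> d double"
proof -
  have "closed_curves \<mu> (filled (\<lambda>k. 0))"
    unfolding closed_curves_def filled_def
    using continuous_fill [of "\<lambda>k. strand k 0"] strand_path strand_avoid(1) fill_periodic by auto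
  moreover have "range (filled (\<lambda>k. 0) i) \<subseteq> S3" if "i < \<mu>" for i
    using fill_S3 [OF that strands_in_disc [of "\<lambda>_. 0"]] by (auto simp: filled_def image_subset_iff simp del: split_paired_All)
  ultimately show ?thesis
    unfolding double_singular_link_def using sites_double double_points by auto
qed

text \<open>The two sites of a pair get opposite crossings, and their charts differ by the rotation
  that changes the sign of e; so both half turns of a ball acquire the same value of e.\<close>

lemma double_resolution_eq:
  assumes i: "i < \<mu>"
  shows "double_resolution d double A i t = filled (\<lambda>k. if (k \<in> A) = e\<^sub>1 k then 1 else - 1) i t"
proof -
  define e where "e = (\<lambda>k. if (k \<in> A) = e\<^sub>1 k then 1 else - 1 :: real)"
  define F where "F = (\<lambda>(k, b). crossing (if (k \<in> A) = b then 1 else - 1))"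
  have F: "F (k, b) = crossing (if b = e\<^sub>1 k then e k else - e k)" for k b
    by (auto simp: F_def e_def)
  let ?at = "\<lambda>s r z. s \<in> double_sites d \<and> r \<in> {1..2} \<and> at_site double s r z i t"
  have val: "chart double s (F s r z, z) = filled e i t" if at: "?at s r z" for s r z
  proof -
    obtain k b where s: "s = (k, b)" "k < d" using at by (auto simp: double_sites_def)
    let ?p = "b = e\<^sub>1 k"
    define r' :: nat where "r' = (if r = 1 then 3 else 1)"
    define y where "y = site_lo ?p + site_len ?p * z"
    have z: "z \<in> {0..1}" and a: "at_site S k r' y i t"
      using at by (auto simp: s at_site_double r'_def y_def)
    have "site_sub ?p (F s r z, z) = (third_strand (strand k (e k)) r' y, y)"
    proof (cases "r = 1")
      case True
      then show ?thesis
        using two_crossings_site [OF P(4) [of k] Q(4) [of k] z, of ?p "e k" "R k"]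
        by (simp add: r'_def strand_def y_def s F)
    next
      case False
      then have "r = 2" using at by auto
      then show ?thesis using site_sub_crossing_2 [of ?p _ z] by (simp add: r'_def y_def s F)
    qed
    moreover have "r' \<in> {1..3}" by (simp add: r'_def)
    ultimately show ?thesis using filled_site [OF s(2) _ a, of e] by (simp add: s)
  qed
  have "fill 2 (double_sites d) double F i t = filled e i t"
  proof (cases "\<exists>s r z. ?at s r z")
    case True
    then obtain s r z where at: "?at s r z" by blast
    \<comment> \<open>By \<open>val\<close> all admissible values equal \<open>filled e i t\<close>,
      so \<open>THE\<close> is determined whichever site is chosen.\<close>
    have "(\<exists>s\<in>double_sites d. \<exists>r\<in>{1..2}. \<exists>z. at_site double s r z i t \<and> p = chart double s (F s r z, z)) \<longleftrightarrow> p = filled e i t" for p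
      using at val by metis
    moreover have "\<exists>s\<in>double_sites d. \<exists>r\<in>{1..2}. \<exists>z. at_site double s r z i t" using at by blast
    ultimately show ?thesis by (simp only: fill_def if_True the_eq_trivial)
  next
    case False
    have "fill 2 (double_sites d) double F i t = filled (\<lambda>k. 0) i t"
      using False unfolding fill_def by auto
    \<comment> \<open>A parameter of the third strand outside both sites is not on a half turn, and
      only the half turns depend on e.\<close>
    also have "\<dots> = filled e i t"
    proof (cases rule: fill_cases [of i t])
      case (1 k r z)
      have "third_strand (strand k 0) r z = third_strand (strand k (e k)) r z"
      proof (cases "r = 3")
        case True
        have "z \<noteq> site_lo p + site_len p * y" if "y \<in> {0..1}" for p y
        proof
          assume "z = site_lo p + site_len p * y"
          moreover define b where "b = (p = e\<^sub>1 k)"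
          moreover have "(b = e\<^sub>1 k) = p" by (auto simp: b_def)
          ultimately have "?at (k, b) 1 y"
            using 1 True that by (simp add: at_site_double double_sites_def)
          then show False using False by blast
        qed
        from two_crossings_off_site [OF this] show ?thesis by (simp add: True strand_def)
      qed simp
      then show ?thesis using 1(5) by (simp add: filled_def)
    next
      case 2
      then show ?thesis by (simp add: filled_def)
    qed
    finally show ?thesis .
  qed
  then show ?thesis by (simp add: double_resolution_def F_def e_def)
qed

text \<open>For k in A the value of e is the sign of the exponent of the first generator, giving the
  clasp; otherwise it is the opposite sign, giving the trivial strand. Both directions are stated
  for the transfer of the linking class.\<close>

lemma double_resolution_isotopic:
  "ambient_isotopic \<mu> (double_resolution d double A) (borromean_resolution d S \<sigma> A)"
  "ambient_isotopic \<mu> (borromean_resolution d S \<sigma> A) (double_resolution d double A)"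
proof -
  define e where "e = (\<lambda>k. if (k \<in> A) = e\<^sub>1 k then 1 else - 1 :: real)"
  define b where "b k = (if k \<in> A then \<kappa> k else linepath (base_point 3) (base_point 3))" for k
  have hom: "homotopic_paths disc (strand k (e k)) (b k)" for k
    using paths [of k] by (auto simp: clasp_paths_def strand_def e_def b_def sgn_of_def)
  have D: "double_resolution d double A i t = fill 3 {..<d} S (\<lambda>k. third_strand (strand k (e k))) i t" if "i < \<mu>" for i t
    unfolding double_resolution_eq [OF that] filled_def e_def ..
  have B: "borromean_resolution d S \<sigma> A = fill 3 {..<d} S (\<lambda>k. third_strand (b k))"
  proof -
    have "(\<lambda>k. if k \<in> A then borromean_clasp (\<sigma> k) else trivial_strands) = (\<lambda>k. third_strand (b k))"
      using paths by (auto simp: b_def clasp_paths_def trivial_strands_eq)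
    then show ?thesis by (simp only: borromean_resolution_def)
  qed
  show "ambient_isotopic \<mu> (double_resolution d double A) (borromean_resolution d S \<sigma> A)"
    using ambient_isotopic_trans [OF ambient_isotopic_refl fill_homotopic_all [OF hom]] D by (simp add: B)
  show "ambient_isotopic \<mu> (borromean_resolution d S \<sigma> A) (double_resolution d double A)"
    using ambient_isotopic_trans [OF fill_homotopic_all [OF homotopic_paths_sym [OF hom]] ambient_isotopic_refl] D by (simp add: B)
qed

end

section \<open>Comparison of the alternating sums\<close>

lemma alternating_cong:
  "(\<And>A. A \<subseteq> {..<m} \<Longrightarrow> f A = g A) \<Longrightarrow> alternating m f = alternating m g"
proof (induction m arbitrary: f g)
  case (Suc m)
  have "alternating m (\<lambda>A. f (insert m A)) = alternating m (\<lambda>A. g (insert m A))"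
    by (intro Suc.IH Suc.prems) auto
  moreover have "alternating m f = alternating m g"
    by (intro Suc.IH Suc.prems) auto
  ultimately show ?case by simp
qed simp

text \<open>The double resolutions inherit membership in the linking class from the Borromean ones,
  so invariance of V identifies the two sums and the hypothesis on V applies in the same degree
  d.\<close>

lemma borromean_type_if_double_type:
  assumes inv: "link_invariant_on \<mu> (linking_class \<mu> M) V" and V: "double_type \<mu> M n V"
  shows "borromean_type \<mu> M n V"
  unfolding borromean_type_def
proof (intro allI impI)
  fix d S \<sigma>
  assume d: "n + 1 \<le> d" and S: "borromean_singular_link \<mu> d S"
    and res: "\<forall>A\<subseteq>{..<d}. borromean_resolution d S \<sigma> A \<in> linking_class \<mu> M"
  have "\<forall>k. \<exists>\<kappa> P Q R. clasp_paths (\<sigma> k) \<kappa> P Q R" using ex_clasp_paths by blast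
  then obtain \<kappa> P Q R where "\<And>k. clasp_paths (\<sigma> k) (\<kappa> k) (P k) (Q k) (R k)" by metis
  then interpret clasp_sites \<mu> d S \<sigma> \<kappa> P Q R
    using S by unfold_locales
  have D: "double_resolution d double A \<in> linking_class \<mu> M" if "A \<subseteq> {..<d}" for A
    using linking_class_ambient_isotopic [OF double_resolution_isotopic(2,1)] res that by blast
  have "alternating d (\<lambda>A. V (borromean_resolution d S \<sigma> A)) = alternating d (\<lambda>A. V (double_resolution d double A))"
  proof (rule alternating_cong)
    fix A assume A: "A \<subseteq> {..<d}"
    show "V (borromean_resolution d S \<sigma> A) = V (double_resolution d double A)"
      using inv res A D [OF A] ambient_isotopic_imp_isotopic [OF double_resolution_isotopic(2)]
      unfolding link_invariant_on_def by blast
  qed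
  also have "\<dots> = 0"
    using V d double_singular D unfolding double_type_def by blast
  finally show "alternating d (\<lambda>A. V (borromean_resolution d S \<sigma> A)) = 0" .
qed

theorem theorem5:
  fixes \<mu> n :: nat
    and M :: "nat \<Rightarrow> nat \<Rightarrow> int"
    and V :: "point curves \<Rightarrow> 'a::ab_group_add"
  assumes "link_invariant_on \<mu> (linking_class \<mu> M) V"
    and "double_type \<mu> M n V"
  shows "borromean_finite_type \<mu> M V \<and> borromean_type \<mu> M n V"
  using borromean_type_if_double_type [OF assms] by (auto simp: borromean_finite_type_def)

end
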